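(* Let $\mu$ be a probability measure on $\mathbb{R}$ such that $\int e^{\theta x^2}\mu(dx)<\infty$ for some $\theta>0$. For each $n$, let $X=\{x_{i,j}\}$ be a random real symmetric $n\times n$ matrix whose entries $x_{i,j}$, $j\ge i$, are independent with common distribution $\mu$, and let $Q_n$ be the law of $k(x,y)=\sum_{i,j=1}^n x_{i,j}\mathbf 1_{J^n_i}(x)\mathbf 1_{J^n_j}(y)$, $J^n_i=[\frac{i-1}{n},\frac in]$. Then for every symmetric kernel $f\in\mathcal K$ with $I(f)=\frac12\int_D h(f(x,y))\,dxdy<\infty$ and every $\delta>0$, $$\liminf_{n\to\infty}\frac1{n^2}\log Q_n\big[d_\square(k,f)<\delta\big]\ge -I(f).$$
   Context: $M(\theta)=\int e^{\theta x}\mu(dx)$, $h(x)=\sup_\theta[\theta x-\log M(\theta)]$ (Cramér rate function). $D=[0,1]^2$; $\mathcal K$ is the space of measurable symmetric kernels on $D$ with $\int_D k^2<\infty$. The cut distance is $d_\square(k_1,k_2)=\sup_{A,B}\left|\int_{A\times B}(k_1-k_2)\,dxdy\right|$, supremum over Borel $A,B\subset[0,1]$. *)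

theory Defs
  imports "HOL-Probability.Probability"
begin

definition mgf :: "real measure \<Rightarrow> real \<Rightarrow> real" where
  "mgf \<mu> \<theta> = (\<integral>x. exp (\<theta> * x) \<partial>\<mu>)"

definition cramer_rate :: "real measure \<Rightarrow> real \<Rightarrow> ereal" where
  "cramer_rate \<mu> x = (SUP \<theta>::real. ereal (\<theta> * x - ln (mgf \<mu> \<theta>)))"

definition unit_sq :: "(real \<times> real) set" where
  "unit_sq = {0..1} \<times> {0..1}"

definition kernel_space :: "(real \<times> real \<Rightarrow> real) set" where
  "kernel_space = {k. k \<in> borel_measurable (lebesgue_on unit_sq)
       \<and> (\<forall>x\<in>{0..1}. \<forall>y\<in>{0..1}. k (x, y) = k (y, x))
       \<and> set_integrable lebesgue unit_sq (\<lambda>p. (k p)\<^sup>2)}"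

definition cut_dist :: "(real \<times> real \<Rightarrow> real) \<Rightarrow> (real \<times> real \<Rightarrow> real) \<Rightarrow> real" where
  "cut_dist k1 k2 = (SUP AB \<in> {(A, B). A \<in> sets borel \<and> B \<in> sets borel \<and> A \<subseteq> {0..1} \<and> B \<subseteq> {0..1}}.
      \<bar>LINT p:(fst AB \<times> snd AB)|lebesgue. (k1 p - k2 p)\<bar>)"

definition rate_I :: "real measure \<Rightarrow> (real \<times> real \<Rightarrow> real) \<Rightarrow> ennreal" where
  "rate_I \<mu> f = (\<integral>\<^sup>+ p\<in>unit_sq. e2ennreal (cramer_rate \<mu> (f p)) \<partial>lebesgue) / 2"

definition upper_idx :: "nat \<Rightarrow> (nat \<times> nat) set" where
  "upper_idx n = {(i, j). i \<le> j \<and> j < n}"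

definition sym_entry :: "(nat \<times> nat \<Rightarrow> real) \<Rightarrow> nat \<Rightarrow> nat \<Rightarrow> real" where
  "sym_entry x i j = (if i \<le> j then x (i, j) else x (j, i))"

text \<open>J^n_i = [(i-1)/n, i/n] for 1-based i; here 0-based: [i/n, (i+1)/n].\<close>
definition block_int :: "nat \<Rightarrow> nat \<Rightarrow> real set" where
  "block_int n i = {real i / real n .. (real i + 1) / real n}"

definition matrix_kernel :: "nat \<Rightarrow> (nat \<times> nat \<Rightarrow> real) \<Rightarrow> real \<times> real \<Rightarrow> real" where
  "matrix_kernel n x = (\<lambda>(s, t). \<Sum>i<n. \<Sum>j<n.
      sym_entry x i j * indicator (block_int n i) s * indicator (block_int n j) t)"

definition entries_law :: "real measure \<Rightarrow> nat \<Rightarrow> (nat \<times> nat \<Rightarrow> real) measure" where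
  "entries_law \<mu> n = PiM (upper_idx n) (\<lambda>_. \<mu>)"

definition Qn_ball :: "real measure \<Rightarrow> nat \<Rightarrow> (real \<times> real \<Rightarrow> real) \<Rightarrow> real \<Rightarrow> real" where
  "Qn_ball \<mu> n f \<delta> = measure (entries_law \<mu> n)
      {x \<in> space (entries_law \<mu> n). cut_dist (matrix_kernel n x) f < \<delta>}"

definition elog :: "real \<Rightarrow> ereal" where
  "elog p = (if p = 0 then - \<infinity> else ereal (ln p))"

end

theory Submission
  imports Defs
begin

text \<open>The lower bound is obtained by a change of measure. Choose \<open>m\<close> such that the step kernel of
  the averages of \<open>f\<close> over the \<open>m \<times> m\<close> grid is close to \<open>f\<close> in \<open>L\<^sup>1\<close>; by Jensen's inequality its
  rate does not exceed that of \<open>f\<close>. Each of the finitely many averages \<open>a\<close> with \<open>h(a) < \<infinity>\<close> is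
  approximately the mean of a truncated exponential tilt of \<open>\<mu>\<close> whose relative entropy is at most
  \<open>h(a)\<close> plus a small error. Give the entries of the \<open>n \<times> n\<close> matrix the tilted laws of the
  coarse cells they fall into. Under this product law the cut norm of the centred matrix is a maximum
  of \<open>4^n\<close> linear forms in bounded independent variables, so by Hoeffding's inequality it is small
  with probability tending to one, and so is the deviation of the log likelihood ratio from its mean.
  As only the entries on and above the diagonal are independent, the entropy cost is half of the
  integral of the rate, up to the contribution of the \<open>n\<close> diagonal entries.\<close>

subsection \<open>Exponential tilting\<close>

text \<open>The union over 4^n pairs of index sets is affordable because a centred sum over order
  n^2 independent entries exceeds e n^2 only with probability exp(-\<beta> n^2). The log likelihood
  ratio is, on the truncated range, an affine function of the entries, so it joins the same family
  of linear forms and no separate law of large numbers is needed; probability 1/2 of the good event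
  is already enough at the scale n^2. Truncation provides the boundedness for Hoeffding's inequality
  and costs nothing in the change of measure, which only needs an upper bound of the density. Three
  obstacles shape the rest. The kernel f is merely Lebesgue measurable, so a symmetric Borel version
  g takes its place. The number n is in general no multiple of m, so coarse parameters are
  transferred to the fine grid by a rounding rule that is consistent only in the limit. The event is
  defined by an uncountable supremum, and its measurability has to be derived from continuity in the
  entries.\<close>

locale gauss_tail = prob_space \<mu> for \<mu> :: "real measure" +
  assumes sets_mu [measurable_cong]: "sets \<mu> = sets borel"
    and gauss_int: "\<exists>\<theta>>0. integrable \<mu> (\<lambda>x. exp (\<theta> * x\<^sup>2))"
begin

text \<open>Completing the square bounds t |x| by \<theta> x^2 + t^2 / (4 \<theta>), so the Gaussian
  moment dominates exponential moments of every order and M is finite on the whole line.\<close>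

lemma integrable_exp_abs: "integrable \<mu> (\<lambda>x. exp (t * \<bar>x\<bar>))"
proof -
  obtain \<theta> where \<theta>: "\<theta> > 0" "integrable \<mu> (\<lambda>x. exp (\<theta> * x\<^sup>2))"
    using gauss_int by blast
  have "t * \<bar>x\<bar> \<le> \<theta> * x\<^sup>2 + t\<^sup>2 / (4 * \<theta>)" for x :: real
  proof -
    have "0 \<le> (2 * \<theta> * \<bar>x\<bar> - t)\<^sup>2 / (4 * \<theta>)"
      using \<theta> by simp
    also have "\<dots> = \<theta> * x\<^sup>2 + t\<^sup>2 / (4 * \<theta>) - t * \<bar>x\<bar>"
      using \<theta> by (simp add: power2_eq_square field_simps)
    finally show ?thesis by simp
  qed
  then have le: "exp (t * \<bar>x\<bar>) \<le> exp (t\<^sup>2 / (4 * \<theta>)) * exp (\<theta> * x\<^sup>2)" for x :: real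
    by (simp add: exp_add [symmetric] add.commute)
  show ?thesis
    by (rule Bochner_Integration.integrable_bound
          [of _ "\<lambda>x. exp (t\<^sup>2 / (4 * \<theta>)) * exp (\<theta> * x\<^sup>2)"])
       (use \<theta> le in auto)
qed

lemma integrable_bound_exp:
  assumes [measurable]: "g \<in> borel_measurable borel"
    and "\<And>x. \<bar>g x\<bar> \<le> C * exp (t * \<bar>x\<bar>)"
  shows "integrable \<mu> g"
proof (rule Bochner_Integration.integrable_bound [of _ "\<lambda>x. C * exp (t * \<bar>x\<bar>)"])
  show "integrable \<mu> (\<lambda>x. C * exp (t * \<bar>x\<bar>))"
    using integrable_exp_abs by simp
  show "AE x in \<mu>. norm (g x) \<le> norm (C * exp (t * \<bar>x\<bar>))"
    using assms(2) by (intro AE_I2) (metis abs_ge_self order_trans real_norm_def)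
qed measurable

lemma integrable_exp: "integrable \<mu> (\<lambda>x. exp (t * x))"
  by (rule integrable_bound_exp [of _ 1 "\<bar>t\<bar>"]) (auto simp: abs_mult [symmetric])

lemma abs_le_exp: "\<bar>x :: real\<bar> \<le> exp \<bar>x\<bar>"
  using exp_ge_add_one_self [of "\<bar>x\<bar>"] by linarith

lemma integrable_x_exp: "integrable \<mu> (\<lambda>x. x * exp (t * x))"
proof (rule integrable_bound_exp [of _ 1 "\<bar>t\<bar> + 1"])
  fix x :: real
  have "\<bar>x\<bar> * exp (t * x) \<le> exp \<bar>x\<bar> * exp (\<bar>t\<bar> * \<bar>x\<bar>)"
    using abs_le_exp [of x] by (intro mult_mono) (auto simp: abs_mult [symmetric])
  then show "\<bar>x * exp (t * x)\<bar> \<le> 1 * exp ((\<bar>t\<bar> + 1) * \<bar>x\<bar>)"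
    by (simp add: abs_mult exp_add [symmetric] algebra_simps)
qed measurable

text \<open>Serves as the majorant of the second order remainder in \<open>mgf_expand\<close>; the
  extra factor \<open>exp \<bar>x\<bar>\<close> covers all increments of the tilt of size at most
  1.\<close>

lemma integrable_sq_exp: "integrable \<mu> (\<lambda>x. x\<^sup>2 * exp (t * x + \<bar>x\<bar>))"
proof (rule integrable_bound_exp [of _ 1 "\<bar>t\<bar> + 3"])
  fix x :: real
  have "x\<^sup>2 = \<bar>x\<bar> * \<bar>x\<bar>"
    by (simp add: power2_eq_square)
  also have "\<dots> \<le> exp \<bar>x\<bar> * exp \<bar>x\<bar>"
    by (intro mult_mono abs_le_exp) auto
  finally have "x\<^sup>2 * exp (t * x + \<bar>x\<bar>) \<le> (exp \<bar>x\<bar> * exp \<bar>x\<bar>) * exp (\<bar>t\<bar> * \<bar>x\<bar> + \<bar>x\<bar>)"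
    by (intro mult_mono) (auto simp: abs_mult [symmetric])
  then show "\<bar>x\<^sup>2 * exp (t * x + \<bar>x\<bar>)\<bar> \<le> 1 * exp ((\<bar>t\<bar> + 3) * \<bar>x\<bar>)"
    by (simp add: abs_mult exp_add [symmetric] algebra_simps)
qed measurable

lemma mgf_pos: "mgf \<mu> t > 0"
proof -
  have "mgf \<mu> t \<noteq> 0"
  proof
    assume "mgf \<mu> t = 0"
    then have "AE x in \<mu>. exp (t * x) = 0"
      unfolding mgf_def using integral_nonneg_eq_0_iff_AE [OF integrable_exp] by auto
    then show False by auto
  qed
  moreover have "mgf \<mu> t \<ge> 0"
    unfolding mgf_def by (rule integral_nonneg_AE) auto
  ultimately show ?thesis by linarith
qed

end

text \<open>The inequality exp v - 1 \<le> v exp v at v = u bounds the remainder exp u - 1 - u by u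
  (exp u - 1), whose second factor is again of order |u|.\<close>

lemma exp_quadratic_bound: "exp (u :: real) \<le> 1 + u + u\<^sup>2 * exp \<bar>u\<bar>"
proof -
  have 1: "exp v - 1 \<le> v * exp v" for v :: real
  proof -
    have "(1 - v) * exp v \<le> exp (- v) * exp v"
      using exp_ge_add_one_self [of "-v"] by (intro mult_right_mono) auto
    then show ?thesis by (simp add: exp_minus algebra_simps)
  qed
  have 2: "\<bar>exp u - 1\<bar> \<le> \<bar>u\<bar> * exp \<bar>u\<bar>"
  proof (cases "u \<ge> 0")
    case True
    then show ?thesis using 1 [of u] by simp
  next
    case False
    have "1 - exp u \<le> - u" using exp_ge_add_one_self [of u] by linarith
    also have "\<dots> \<le> \<bar>u\<bar> * exp \<bar>u\<bar>"
      using mult_left_mono [of 1 "exp \<bar>u\<bar>" "\<bar>u\<bar>"] False by auto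
    finally show ?thesis using False by simp
  qed
  have "exp u - 1 - u \<le> u * (exp u - 1)" using 1 [of u] by (simp add: algebra_simps)
  also have "\<dots> \<le> \<bar>u\<bar> * \<bar>exp u - 1\<bar>" by (metis abs_ge_self abs_mult)
  also have "\<dots> \<le> \<bar>u\<bar> * (\<bar>u\<bar> * exp \<bar>u\<bar>)" using 2 by (intro mult_left_mono) auto
  finally show ?thesis by (simp add: power2_eq_square)
qed

context gauss_tail
begin

text \<open>This is the derivative of M, see \<open>DERIV_mgf\<close>; hence
  \<open>mgf1 t / mgf \<mu> t\<close> is the mean of \<mu> tilted by exp (t x).\<close>

definition mgf1 :: "real \<Rightarrow> real" where
  "mgf1 t = (\<integral>x. x * exp (t * x) \<partial>\<mu>)"

text \<open>The remainder is the integral of exp (t x) (exp (s x) - 1 - s x). This integrand is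
  nonnegative by convexity of exp and at most s^2 times the function of
  \<open>integrable_sq_exp\<close>.\<close>

lemma mgf_expand:
  obtains C where "\<And>s. \<bar>s\<bar> \<le> 1 \<Longrightarrow> \<bar>mgf \<mu> (t + s) - mgf \<mu> t - s * mgf1 t\<bar> \<le> C * s\<^sup>2"
proof
  fix s :: real assume s: "\<bar>s\<bar> \<le> 1"
  let ?D = "\<lambda>x. exp ((t + s) * x) - exp (t * x) - s * (x * exp (t * x))"
  have 0: "mgf \<mu> (t + s) - mgf \<mu> t - s * mgf1 t = (\<integral>x. ?D x \<partial>\<mu>)"
    unfolding mgf_def mgf1_def using integrable_exp integrable_x_exp by simp
  have D: "?D x = exp (t * x) * (exp (s * x) - 1 - s * x)" for x
    by (simp add: exp_add algebra_simps)
  have D0: "0 \<le> ?D x" for x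
    unfolding D using exp_ge_add_one_self [of "s * x"] by (intro mult_nonneg_nonneg) (simp, linarith)
  have D1: "?D x \<le> s\<^sup>2 * (x\<^sup>2 * exp (t * x + \<bar>x\<bar>))" for x
  proof -
    have "exp (s * x) - 1 - s * x \<le> (s * x)\<^sup>2 * exp \<bar>s * x\<bar>"
      using exp_quadratic_bound [of "s * x"] by linarith
    also have "\<dots> \<le> (s * x)\<^sup>2 * exp \<bar>x\<bar>"
      using s by (intro mult_left_mono) (auto simp: abs_mult mult_left_le_one_le)
    finally show ?thesis unfolding D
      using mult_left_mono [of "exp (s * x) - 1 - s * x" "(s * x)\<^sup>2 * exp \<bar>x\<bar>" "exp (t * x)"]
      by (simp add: exp_add power_mult_distrib mult_ac)
  qed
  have "(\<integral>x. ?D x \<partial>\<mu>) \<le> (\<integral>x. s\<^sup>2 * (x\<^sup>2 * exp (t * x + \<bar>x\<bar>)) \<partial>\<mu>)"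
    by (rule integral_mono)
       (use integrable_exp integrable_x_exp integrable_sq_exp D1 in auto)
  moreover have "0 \<le> (\<integral>x. ?D x \<partial>\<mu>)"
    by (rule integral_nonneg_AE) (use D0 in auto)
  ultimately show "\<bar>mgf \<mu> (t + s) - mgf \<mu> t - s * mgf1 t\<bar>
      \<le> (\<integral>x. x\<^sup>2 * exp (t * x + \<bar>x\<bar>) \<partial>\<mu>) * s\<^sup>2"
    unfolding 0 by (simp add: mult.commute)
qed

lemma DERIV_mgf: "(mgf \<mu> has_real_derivative mgf1 t) (at t)"
proof -
  obtain C where C: "\<And>s. \<bar>s\<bar> \<le> 1 \<Longrightarrow> \<bar>mgf \<mu> (t + s) - mgf \<mu> t - s * mgf1 t\<bar> \<le> C * s\<^sup>2"
    using mgf_expand by blast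
  have lim: "((\<lambda>s. (mgf \<mu> (t + s) - mgf \<mu> t) / s - mgf1 t) \<longlongrightarrow> 0) (at 0)"
  proof (rule Lim_null_comparison)
    show "\<forall>\<^sub>F s in at 0. norm ((mgf \<mu> (t + s) - mgf \<mu> t) / s - mgf1 t) \<le> C * \<bar>s\<bar>"
      unfolding eventually_at
    proof (intro exI [of _ 1] conjI ballI impI)
      fix s :: real assume s: "s \<noteq> 0 \<and> dist s 0 < 1"
      then have "norm ((mgf \<mu> (t + s) - mgf \<mu> t) / s - mgf1 t)
          = \<bar>mgf \<mu> (t + s) - mgf \<mu> t - s * mgf1 t\<bar> / \<bar>s\<bar>"
        by (simp add: field_simps flip: abs_divide)
      also have "\<dots> \<le> C * s\<^sup>2 / \<bar>s\<bar>"
        using C [of s] s by (intro divide_right_mono) (auto simp: dist_real_def)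
      also have "\<dots> = C * \<bar>s\<bar>"
        using s by (simp add: power2_eq_square field_simps flip: abs_mult)
      finally show "norm ((mgf \<mu> (t + s) - mgf \<mu> t) / s - mgf1 t) \<le> C * \<bar>s\<bar>" .
    qed auto
    show "((\<lambda>s. C * \<bar>s\<bar>) \<longlongrightarrow> 0) (at 0)"
      by (auto intro!: tendsto_eq_intros)
  qed
  then show ?thesis
    unfolding DERIV_def using LIM_zero_iff by blast
qed

text \<open>The quadratic penalty makes the infimum of \<open>ln M(t) - a t\<close> attained even when
  \<open>a\<close> lies on the boundary of the convex hull of the support.\<close>

lemma ex_tilt:
  assumes c: "\<And>t. t * a - ln (mgf \<mu> t) \<le> c" and "e > 0"
  obtains t where "\<bar>mgf1 t / mgf \<mu> t - a\<bar> \<le> e"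
    "t * (mgf1 t / mgf \<mu> t) - ln (mgf \<mu> t) \<le> c"
proof -
  have c0: "c \<ge> 0"
    using c [of 0] prob_space by (simp add: mgf_def)
  \<comment> \<open>This choice gives 2 \<eta> c < e^2, and c + 1 avoids division by zero. A
    minimiser t of F satisfies F t \<le> F 0 = 0, hence \<eta> t^2 / 2 \<le> c and |\<eta> t| <
    e.\<close>
  define \<eta> where "\<eta> = e\<^sup>2 / (2 * (c + 1))"
  have \<eta>: "\<eta> > 0" using c0 \<open>e > 0\<close> by (simp add: \<eta>_def)
  define F where "F t = ln (mgf \<mu> t) - t * a + \<eta> * t\<^sup>2 / 2" for t
  define R where "R = e / \<eta>"
  have R: "R > 0" using \<eta> \<open>e > 0\<close> by (simp add: R_def)
  have F0: "F 0 = 0" using prob_space by (simp add: F_def mgf_def)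
  have Fge: "F t \<ge> \<eta> * t\<^sup>2 / 2 - c" for t
    using c [of t] by (simp add: F_def)
  have dF: "(F has_real_derivative (mgf1 t / mgf \<mu> t - a + \<eta> * t)) (at t)" for t
    unfolding F_def using mgf_pos [of t]
    by (auto intro!: derivative_eq_intros DERIV_mgf simp: field_simps)
  have "continuous_on {-R..R} F"
    using dF by (auto intro!: continuous_at_imp_continuous_on DERIV_isCont)
  then obtain t where t: "t \<in> {-R..R}" "\<And>s. s \<in> {-R..R} \<Longrightarrow> F t \<le> F s"
    using continuous_attains_inf [of "{-R..R}" F] R by auto
  have Ft0: "F t \<le> 0" using t(2) [of 0] R F0 by simp
  have "\<eta> * t\<^sup>2 / 2 \<le> c" using Fge [of t] Ft0 by linarith
  then have "(\<eta> * t)\<^sup>2 \<le> 2 * \<eta> * c"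
    using \<eta> by (simp add: power2_eq_square field_simps)
  also have "\<dots> < e\<^sup>2"
  proof -
    have "2 * \<eta> * c = e\<^sup>2 * (c / (c + 1))"
      using c0 by (simp add: \<eta>_def divide_simps)
    also have "\<dots> < e\<^sup>2 * 1"
      using c0 \<open>e > 0\<close> by (intro mult_strict_left_mono) (auto simp: divide_simps)
    finally show ?thesis by simp
  qed
  finally have small: "\<bar>\<eta> * t\<bar> < e"
    using \<open>e > 0\<close> by (metis abs_less_iff abs_le_square_iff abs_of_pos linorder_not_le)
  then have tR: "\<bar>t\<bar> < R" using \<eta> by (simp add: R_def abs_mult field_simps)
  \<comment> \<open>Since |t| < R, the minimiser over [-R, R] is interior, and the vanishing
    derivative of F identifies the tilted mean as a - \<eta> t.\<close>
  have "mgf1 t / mgf \<mu> t - a + \<eta> * t = 0"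
  proof (rule DERIV_local_min [OF dF, of "R - \<bar>t\<bar>"])
    show "\<forall>y. \<bar>t - y\<bar> < R - \<bar>t\<bar> \<longrightarrow> F t \<le> F y"
      by (intro allI impI t(2)) (unfold atLeastAtMost_iff, linarith)
  qed (use tR in auto)
  then have m: "mgf1 t / mgf \<mu> t = a - \<eta> * t" by linarith
  show ?thesis
  proof
    show "\<bar>mgf1 t / mgf \<mu> t - a\<bar> \<le> e" unfolding m using small by simp
    \<comment> \<open>Replacing a by the mean a - \<eta> t lowers the value by \<eta> t^2, so the
      bound c survives without loss.\<close>
    have "t * (mgf1 t / mgf \<mu> t) - ln (mgf \<mu> t) = (t * a - ln (mgf \<mu> t)) - \<eta> * t\<^sup>2"
      unfolding m by (simp add: algebra_simps power2_eq_square)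
    also have "\<dots> \<le> c" using c [of t] \<eta> by (smt (verit) mult_nonneg_nonneg zero_le_power2)
    finally show "t * (mgf1 t / mgf \<mu> t) - ln (mgf \<mu> t) \<le> c" .
  qed
qed

text \<open>On [-K, K] the log density is t x - l, so the third quantity is the relative entropy of
  the truncated tilt with respect to \<mu>. Mass, mean and entropy of the tilt cut off at n converge
  to those of the full tilt by dominated convergence; \<open>l\<close> is the logarithm of the
  truncated mass.\<close>

lemma ex_truncated_tilt:
  assumes c: "\<And>t. t * a - ln (mgf \<mu> t) \<le> c" and "e > 0"
  obtains t l K where "(\<integral>x. indicator {-K..K} x * exp (t * x - l) \<partial>\<mu>) = 1"
    "\<bar>(\<integral>x. x * (indicator {-K..K} x * exp (t * x - l)) \<partial>\<mu>) - a\<bar> \<le> e"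
    "t * (\<integral>x. x * (indicator {-K..K} x * exp (t * x - l)) \<partial>\<mu>) - l \<le> c + e"
proof -
  obtain t where t: "\<bar>mgf1 t / mgf \<mu> t - a\<bar> \<le> e / 2"
    "t * (mgf1 t / mgf \<mu> t) - ln (mgf \<mu> t) \<le> c"
    using ex_tilt [OF c, of "e / 2"] \<open>e > 0\<close> by auto
  define Z where "Z n = (\<integral>x. indicator {-real n..real n} x * exp (t * x) \<partial>\<mu>)" for n
  define Y where "Y n = (\<integral>x. x * (indicator {-real n..real n} x * exp (t * x)) \<partial>\<mu>)" for n
  have ind: "(\<lambda>n. indicator {-real n..real n} x :: real) \<longlonglongrightarrow> 1" for x
  proof (rule tendsto_eventually)
    show "\<forall>\<^sub>F n in sequentially. indicator {-real n..real n} x = (1 :: real)"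
      using eventually_ge_at_top [of "nat \<lceil>\<bar>x\<bar>\<rceil>"]
      by eventually_elim (auto simp: indicator_def)
  qed
  have Z: "Z \<longlonglongrightarrow> mgf \<mu> t"
    unfolding Z_def [abs_def] mgf_def
  proof (rule integral_dominated_convergence [where w = "\<lambda>x. exp (t * x)"])
    show "AE x in \<mu>. (\<lambda>n. indicator {-real n..real n} x * exp (t * x)) \<longlonglongrightarrow> exp (t * x)"
      using tendsto_mult_right [OF ind] by (intro AE_I2) fastforce
  qed (use integrable_exp in \<open>auto simp: indicator_def\<close>)
  have Y: "Y \<longlonglongrightarrow> mgf1 t"
    unfolding Y_def [abs_def] mgf1_def
  proof (rule integral_dominated_convergence [where w = "\<lambda>x. \<bar>x * exp (t * x)\<bar>"])
    have "(\<lambda>n. indicator {-real n..real n} x * (x * exp (t * x))) \<longlonglongrightarrow> x * exp (t * x)" for x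
      using tendsto_mult_right [OF ind] by fastforce
    then show "AE x in \<mu>. (\<lambda>n. x * (indicator {-real n..real n} x * exp (t * x))) \<longlonglongrightarrow> x * exp (t * x)"
      by (simp add: mult_ac)
    show "integrable \<mu> (\<lambda>x. \<bar>x * exp (t * x)\<bar>)"
      using integrable_x_exp by (rule integrable_abs)
  qed (auto simp: indicator_def abs_mult)
  have pos: "\<forall>\<^sub>F n in sequentially. Z n > 0"
    using order_tendstoD(1) [OF Z mgf_pos] .
  have q: "(\<lambda>n. Y n / Z n) \<longlonglongrightarrow> mgf1 t / mgf \<mu> t"
    using Y Z mgf_pos [of t] by (intro tendsto_divide) auto
  have r: "(\<lambda>n. t * (Y n / Z n) - ln (Z n)) \<longlonglongrightarrow> t * (mgf1 t / mgf \<mu> t) - ln (mgf \<mu> t)"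
    using mgf_pos [of t] by (intro tendsto_diff tendsto_mult tendsto_const tendsto_ln q Z) auto
  have "\<forall>\<^sub>F n in sequentially. \<bar>Y n / Z n - mgf1 t / mgf \<mu> t\<bar> < e / 2"
    using tendstoD [OF q, of "e / 2"] \<open>e > 0\<close> by (simp add: dist_real_def)
  moreover have "\<forall>\<^sub>F n in sequentially. t * (Y n / Z n) - ln (Z n) < c + e"
    by (rule order_tendstoD(2) [OF r]) (use t \<open>e > 0\<close> in linarith)
  ultimately have "\<forall>\<^sub>F n in sequentially. Z n > 0 \<and> \<bar>Y n / Z n - mgf1 t / mgf \<mu> t\<bar> < e / 2
      \<and> t * (Y n / Z n) - ln (Z n) < c + e"
    using pos by eventually_elim auto
  then obtain n where n: "Z n > 0" "\<bar>Y n / Z n - mgf1 t / mgf \<mu> t\<bar> < e / 2"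
      "t * (Y n / Z n) - ln (Z n) < c + e"
    by (auto simp: eventually_sequentially)
  have ex: "exp (t * x - ln (Z n)) = exp (t * x) / Z n" for x
    using n by (simp add: exp_diff)
  have i1: "(\<integral>x. indicator {-real n..real n} x * exp (t * x - ln (Z n)) \<partial>\<mu>) = 1"
    unfolding ex using n by (simp add: Z_def)
  have i2: "(\<integral>x. x * (indicator {-real n..real n} x * exp (t * x - ln (Z n))) \<partial>\<mu>) = Y n / Z n"
    unfolding ex by (simp add: Y_def)
  show ?thesis
    by (rule that [of "real n" t "ln (Z n)", OF i1]; unfold i2) (use n t in linarith)+
qed

end

subsection \<open>Product measures\<close>

lemma indep_vars_PiM_coordinates:
  assumes "\<And>i. i \<in> I \<Longrightarrow> prob_space (M i)" and "I \<noteq> {}"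
  shows "prob_space.indep_vars (PiM I M) M (\<lambda>i x. x i) I"
proof -
  interpret P: prob_space "PiM I M"
    by (rule prob_space_PiM) (use assms in auto)
  have "distr (PiM I M) (PiM I M) (\<lambda>x. \<lambda>i\<in>I. x i) = distr (PiM I M) (PiM I M) (\<lambda>x. x)"
    by (intro distr_cong) (auto simp: space_PiM PiE_def extensional_restrict)
  also have "\<dots> = PiM I (\<lambda>i. distr (PiM I M) (M i) (\<lambda>x. x i))"
    unfolding distr_id by (intro PiM_cong refl) (simp add: distr_PiM_component assms)
  finally show ?thesis
    using \<open>I \<noteq> {}\<close> by (subst P.indep_vars_iff_distr_eq_PiM') auto
qed

text \<open>A weighted coordinate lies in an interval of length 2 W K, which turns the Hoeffding
  exponent into t^2 / (2 card I (W K)^2). \<open>N\<close> is any upper bound for the number of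
  coordinates.\<close>

lemma Hoeffding_PiM_linear:
  fixes \<nu> :: "'i \<Rightarrow> real measure" and w :: "'i \<Rightarrow> real"
  assumes I: "finite I"
    and prob: "\<And>i. i \<in> I \<Longrightarrow> prob_space (\<nu> i)"
    and sets: "\<And>i. i \<in> I \<Longrightarrow> sets (\<nu> i) = sets borel"
    and bnd: "\<And>i. i \<in> I \<Longrightarrow> AE x in \<nu> i. \<bar>x\<bar> \<le> K"
    and w: "\<And>i. i \<in> I \<Longrightarrow> \<bar>w i\<bar> \<le> W"
    and pos: "K > 0" "W > 0" and "t \<ge> 0" "N > 0" "real (card I) \<le> N"
  shows "measure (PiM I \<nu>) {x \<in> space (PiM I \<nu>). (\<Sum>i\<in>I. w i * (x i - (\<integral>y. y \<partial>\<nu> i))) \<ge> t}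
    \<le> exp (- t\<^sup>2 / (2 * N * (W * K)\<^sup>2))"
\<comment> \<open>For t = 0 the bound is 1, and for empty \<open>I\<close> with t > 0 the event is
  empty. \<open>indep_vars_PiM_coordinates\<close> asks for a nonempty index set.\<close>
proof (cases "I = {} \<or> t = 0")
  case True
  interpret P: prob_space "PiM I \<nu>"
    by (rule prob_space_PiM) (use prob in auto)
  show ?thesis
  proof (cases "t = 0")
    case False
    then have "{x \<in> space (PiM I \<nu>). (\<Sum>i\<in>I. w i * (x i - (\<integral>y. y \<partial>\<nu> i))) \<ge> t} = {}"
      using True \<open>t \<ge> 0\<close> by auto
    then show ?thesis by (simp only: measure_empty exp_ge_zero)
  qed simp
next
  case False
  interpret P: prob_space "PiM I \<nu>"
    by (rule prob_space_PiM) (use prob in auto)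
  let ?X = "\<lambda>i x. w i * x i"
  have meas: "(\<lambda>x. x) \<in> borel_measurable (\<nu> i)" if "i \<in> I" for i
    using sets [OF that] by (rule measurable_ident_sets)
  have indep: "P.indep_vars (\<lambda>_. borel) ?X I"
  proof (rule P.indep_vars_compose2 [OF indep_vars_PiM_coordinates])
    show "(\<lambda>x. w i * x) \<in> borel_measurable (\<nu> i)" if "i \<in> I" for i
      using meas [OF that] by simp
  qed (use prob False in auto)
  interpret H: Hoeffding_ineq "PiM I \<nu>" I ?X "\<lambda>_. - (W * K)" "\<lambda>_. W * K"
    "\<Sum>i\<in>I. P.expectation (?X i)"
  proof unfold_locales
    fix i assume i: "i \<in> I"
    have "AE x in PiM I \<nu>. \<bar>x i\<bar> \<le> K"
      using AE_PiM_component [where M = \<nu> and I = I and P = "\<lambda>y. \<bar>y\<bar> \<le> K", OF prob i bnd [OF i]] by simp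
    then show "AE x in PiM I \<nu>. w i * x i \<in> {- (W * K)..W * K}"
    proof eventually_elim
      case (elim x)
      have "\<bar>w i * x i\<bar> \<le> W * K"
        unfolding abs_mult using elim w [OF i] pos by (intro mult_mono) auto
      then show ?case by auto
    qed
  qed (use I indep in auto)
  have ex: "P.expectation (?X i) = w i * (\<integral>y. y \<partial>\<nu> i)" if i: "i \<in> I" for i
  proof -
    have "P.expectation (\<lambda>x. x i) = (\<integral>y. y \<partial>(distr (PiM I \<nu>) (\<nu> i) (\<lambda>x. x i)))"
      using i meas [OF i] by (subst integral_distr) auto
    also have "\<dots> = (\<integral>y. y \<partial>\<nu> i)"
      by (simp add: distr_PiM_component prob i)
    finally show ?thesis by simp
  qed
  have sq: "(\<Sum>i\<in>I. (W * K - - (W * K))\<^sup>2) = card I * (4 * (W * K)\<^sup>2)"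
    by (simp add: power2_eq_square)
  have card: "0 < real (card I)" using False I by (simp add: card_gt_0_iff)
  have "{x \<in> space (PiM I \<nu>). (\<Sum>i\<in>I. w i * (x i - (\<integral>y. y \<partial>\<nu> i))) \<ge> t}
      = {x \<in> space (PiM I \<nu>). (\<Sum>i\<in>I. ?X i x) \<ge> (\<Sum>i\<in>I. P.expectation (?X i)) + t}"
  proof -
    have "(\<Sum>i\<in>I. P.expectation (?X i)) = (\<Sum>i\<in>I. w i * (\<integral>y. y \<partial>\<nu> i))"
      by (intro sum.cong ex refl)
    then show ?thesis
      by (simp add: right_diff_distrib sum_subtractf algebra_simps)
  qed
  also have "P.prob \<dots> \<le> exp (- 2 * t\<^sup>2 / (card I * (4 * (W * K)\<^sup>2)))"
    using H.Hoeffding_ineq_ge [OF \<open>t \<ge> 0\<close>] card pos unfolding sq by simp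
  also have "\<dots> = exp (- (t\<^sup>2 / (2 * card I * (W * K)\<^sup>2)))"
    by (simp add: field_simps)
  also have "\<dots> \<le> exp (- (t\<^sup>2 / (2 * N * (W * K)\<^sup>2)))"
    using card pos assms by (auto intro!: divide_left_mono mult_pos_pos)
  finally show ?thesis by simp
qed

text \<open>The two measures are compared on rectangles, where the indicator factors over the
  coordinates and Tonelli's theorem splits the integral into one-dimensional ones.\<close>

lemma PiM_density:
  assumes I: "finite I"
    and M: "\<And>i. prob_space (M i)"
    and f [measurable]: "\<And>i. f i \<in> borel_measurable (M i)"
    and prob: "\<And>i. prob_space (density (M i) (f i))"
  shows "PiM I (\<lambda>i. density (M i) (f i)) = density (PiM I M) (\<lambda>x. \<Prod>i\<in>I. f i (x i))"
proof -
  interpret M: product_prob_space M I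
    by (intro product_prob_spaceI M)
  interpret D: product_prob_space "\<lambda>i. density (M i) (f i)" I
    by (intro product_prob_spaceI prob)
  show ?thesis
  proof (rule D.PiM_eqI [symmetric, OF I])
    show "sets (density (PiM I M) (\<lambda>x. \<Prod>i\<in>I. f i (x i))) = sets (PiM I (\<lambda>i. density (M i) (f i)))"
      by (simp cong: sets_PiM_cong)
    fix A assume "\<And>i. i \<in> I \<Longrightarrow> A i \<in> sets (density (M i) (f i))"
    then have A [measurable]: "\<And>i. i \<in> I \<Longrightarrow> A i \<in> sets (M i)" by simp
    have A': "Pi\<^sub>E I A \<in> sets (PiM I M)"
      using I A by (intro sets_PiM_I_finite) auto
    have "emeasure (density (PiM I M) (\<lambda>x. \<Prod>i\<in>I. f i (x i))) (Pi\<^sub>E I A)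
        = (\<integral>\<^sup>+x. (\<Prod>i\<in>I. f i (x i)) * indicator (Pi\<^sub>E I A) x \<partial>PiM I M)"
      using A' by (subst emeasure_density) auto
    also have "\<dots> = (\<integral>\<^sup>+x. (\<Prod>i\<in>I. f i (x i) * indicator (A i) (x i)) \<partial>PiM I M)"
    proof (rule nn_integral_cong)
      fix x assume x: "x \<in> space (PiM I M)"
      have "indicator (Pi\<^sub>E I A) x = (\<Prod>i\<in>I. indicator (A i) (x i) :: ennreal)"
      proof (cases "\<forall>i\<in>I. x i \<in> A i")
        case True
        then show ?thesis using x by (auto simp: space_PiM PiE_def Pi_def indicator_def)
      next
        case False
        then obtain i where i: "i \<in> I" "x i \<notin> A i" by blast
        then have "(\<Prod>i\<in>I. indicator (A i) (x i) :: ennreal) = 0"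
          using I by (intro prod_zero) (auto simp: indicator_def)
        moreover have "x \<notin> Pi\<^sub>E I A" using i by auto
        ultimately show ?thesis by (metis indicator_simps(2))
      qed
      then show "(\<Prod>i\<in>I. f i (x i)) * indicator (Pi\<^sub>E I A) x
          = (\<Prod>i\<in>I. f i (x i) * indicator (A i) (x i))"
        by (simp add: prod.distrib)
    qed
    also have "\<dots> = (\<Prod>i\<in>I. \<integral>\<^sup>+x. f i x * indicator (A i) x \<partial>M i)"
      using I by (subst M.product_nn_integral_prod) auto
    also have "\<dots> = (\<Prod>i\<in>I. emeasure (density (M i) (f i)) (A i))"
      by (intro prod.cong refl) (simp add: emeasure_density)
    finally show "emeasure (density (PiM I M) (\<lambda>x. \<Prod>i\<in>I. f i (x i))) (Pi\<^sub>E I A)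
        = (\<Prod>i\<in>I. emeasure (density (M i) (f i)) (A i))" .
  qed
qed

text \<open>The density of the tilted law is the exponential of the affine form times indicators of
  the truncation ranges. Dropping the indicators only enlarges it, and on \<open>S\<close> the
  exponential is at most exp t. A lower bound for the tilted law thus becomes one for the original
  law.\<close>

lemma measure_PiM_tilt_le:
  fixes \<mu> :: "real measure" and \<theta> l K :: "'i \<Rightarrow> real"
  defines "\<nu> \<equiv> \<lambda>i. density \<mu> (\<lambda>x. ennreal (indicator {-K i..K i} x * exp (\<theta> i * x - l i)))"
  assumes I: "finite I" and "prob_space \<mu>" and sets: "sets \<mu> = sets borel"
    and prob: "\<And>i. prob_space (\<nu> i)"
    and S: "S \<in> sets (PiM I (\<lambda>_. \<mu>))"
    and le: "\<And>x. x \<in> S \<Longrightarrow> (\<Sum>i\<in>I. \<theta> i * x i - l i) \<le> t"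
  shows "measure (PiM I \<nu>) S \<le> exp t * measure (PiM I (\<lambda>_. \<mu>)) S"
proof -
  let ?g = "\<lambda>i x. ennreal (indicator {-K i..K i} x * exp (\<theta> i * x - l i))"
  interpret \<mu>: prob_space \<mu> by fact
  interpret P: prob_space "PiM I (\<lambda>_. \<mu>)"
    by (rule prob_space_PiM) (use \<mu>.prob_space_axioms in auto)
  interpret Q: prob_space "PiM I \<nu>"
    by (rule prob_space_PiM) (use prob in auto)
  note sets [measurable_cong]
  have eq: "PiM I \<nu> = density (PiM I (\<lambda>_. \<mu>)) (\<lambda>x. \<Prod>i\<in>I. ?g i (x i))"
    unfolding \<nu>_def by (rule PiM_density) (use I prob \<mu>.prob_space_axioms in \<open>auto simp: \<nu>_def\<close>)
  have "emeasure (PiM I \<nu>) S = (\<integral>\<^sup>+x. (\<Prod>i\<in>I. ?g i (x i)) * indicator S x \<partial>PiM I (\<lambda>_. \<mu>))"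
    unfolding eq using S by (subst emeasure_density) auto
  also have "\<dots> \<le> (\<integral>\<^sup>+x. ennreal (exp t) * indicator S x \<partial>PiM I (\<lambda>_. \<mu>))"
  proof (rule nn_integral_mono)
    fix x
    show "(\<Prod>i\<in>I. ?g i (x i)) * indicator S x \<le> ennreal (exp t) * indicator S x"
    proof (cases "x \<in> S")
      case True
      have "(\<Prod>i\<in>I. indicator {-K i..K i} (x i) * exp (\<theta> i * x i - l i))
          \<le> (\<Prod>i\<in>I. exp (\<theta> i * x i - l i))"
        by (intro prod_mono) (auto simp: indicator_def)
      also have "\<dots> = exp (\<Sum>i\<in>I. \<theta> i * x i - l i)"
        using I by (simp add: exp_sum)
      also have "\<dots> \<le> exp t" using le [OF True] by simp
      finally show ?thesis
        using True by (simp add: prod_ennreal ennreal_leI)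
    qed simp
  qed
  also have "\<dots> = ennreal (exp t) * emeasure (PiM I (\<lambda>_. \<mu>)) S"
    using S by (simp add: nn_integral_cmult)
  finally show ?thesis
    by (simp add: P.emeasure_eq_measure Q.emeasure_eq_measure ennreal_mult [symmetric])
qed

lemma integral_density_tilt:
  fixes \<mu> :: "real measure"
  assumes sets: "sets \<mu> = sets borel"
    and nu: "\<nu> = density \<mu> (\<lambda>x. ennreal (indicator {-K..K} x * exp (\<theta> * x - l)))"
    and 1: "(\<integral>x. indicator {-K..K} x * exp (\<theta> * x - l) \<partial>\<mu>) = 1"
  shows "prob_space \<nu>" "AE x in \<nu>. \<bar>x\<bar> \<le> K"
    "(\<integral>x. x \<partial>\<nu>) = (\<integral>x. x * (indicator {-K..K} x * exp (\<theta> * x - l)) \<partial>\<mu>)"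
proof -
  note sets [measurable_cong]
  let ?g = "\<lambda>x. indicator {-K..K} x * exp (\<theta> * x - l)"
  \<comment> \<open>A non-integrable function has Bochner integral 0, so the value 1 forces
    integrability.\<close>
  have int: "integrable \<mu> ?g"
    using 1 not_integrable_integral_eq by fastforce
  have "emeasure \<nu> (space \<nu>) = (\<integral>\<^sup>+x. ennreal (?g x) \<partial>\<mu>)"
    unfolding nu by (auto simp: emeasure_density intro!: nn_integral_cong)
  also have "\<dots> = ennreal 1"
    unfolding 1 [symmetric] using int by (intro nn_integral_eq_integral) auto
  finally show "prob_space \<nu>" by (intro prob_spaceI) simp
  show "AE x in \<nu>. \<bar>x\<bar> \<le> K"
    unfolding nu by (subst AE_density) (auto simp: indicator_def)
  show "(\<integral>x. x \<partial>\<nu>) = (\<integral>x. x * ?g x \<partial>\<mu>)"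
    unfolding nu by (subst integral_density) (auto simp: mult.commute)
qed

subsection \<open>Cut distance of matrix kernels\<close>

text \<open>A bilinear form on a cube is largest at vertices: for fixed \<open>b\<close> it is
  linear in \<open>a\<close>, which may be replaced by the indicator of the rows with positive sum;
  then the columns are treated alike. This is what reduces a supremum over Borel sets to a maximum
  over pairs of index sets.\<close>

lemma bilinear_sum_le_vertices:
  fixes y :: "nat \<Rightarrow> nat \<Rightarrow> real"
  assumes T: "\<And>A B. A \<subseteq> {..<n} \<Longrightarrow> B \<subseteq> {..<n} \<Longrightarrow> (\<Sum>i\<in>A. \<Sum>j\<in>B. y i j) \<le> T"
    and a: "\<And>i. 0 \<le> a i \<and> a i \<le> 1" and b: "\<And>i. 0 \<le> b i \<and> b i \<le> 1"
  shows "(\<Sum>i<n. \<Sum>j<n. y i j * (a i * b j)) \<le> T"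
proof -
  have vertex: "(\<Sum>i<n. c i * v i) \<le> (\<Sum>i\<in>{i. i < n \<and> v i > 0}. v i)"
    if "\<And>i. 0 \<le> c i \<and> c i \<le> 1" for c v :: "nat \<Rightarrow> real"
  proof -
    have "(\<Sum>i<n. c i * v i) \<le> (\<Sum>i<n. if v i > 0 then v i else 0)"
      using that by (intro sum_mono) (auto intro: mult_left_le_one_le simp: mult_le_0_iff not_less)
    also have "\<dots> = (\<Sum>i\<in>{i. i < n \<and> v i > 0}. v i)"
      by (subst sum.inter_filter [symmetric]) (auto simp: lessThan_def)
    finally show ?thesis .
  qed
  let ?A = "{i. i < n \<and> (\<Sum>j<n. y i j * b j) > 0}"
  let ?B = "{j. j < n \<and> (\<Sum>i\<in>?A. y i j) > 0}"
  have "(\<Sum>i<n. \<Sum>j<n. y i j * (a i * b j)) = (\<Sum>i<n. a i * (\<Sum>j<n. y i j * b j))"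
    by (simp add: sum_distrib_left mult_ac)
  also have "\<dots> \<le> (\<Sum>i\<in>?A. \<Sum>j<n. y i j * b j)"
    by (rule vertex) (use a in auto)
  also have "\<dots> = (\<Sum>j<n. b j * (\<Sum>i\<in>?A. y i j))"
    by (subst sum.swap) (simp add: sum_distrib_left mult_ac)
  also have "\<dots> \<le> (\<Sum>j\<in>?B. \<Sum>i\<in>?A. y i j)"
    by (rule vertex) (use b in auto)
  also have "\<dots> = (\<Sum>i\<in>?A. \<Sum>j\<in>?B. y i j)"
    by (rule sum.swap)
  also have "\<dots> \<le> T"
    by (rule T) auto
  finally show ?thesis .
qed

section \<open>Integrals of block kernels over rectangles\<close>

lemma measure_lborel_Times:
  fixes A B :: "real set"
  assumes "A \<in> sets borel" "B \<in> sets borel"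
    and "emeasure lborel A < \<infinity>" "emeasure lborel B < \<infinity>"
  shows "A \<times> B \<in> sets borel"
    and "emeasure lborel (A \<times> B) < \<infinity>"
    and "measure lborel (A \<times> B) = measure lborel A * measure lborel B"
proof -
  show "A \<times> B \<in> sets borel"
    using assms borel_Times by blast
  have e: "emeasure lborel (A \<times> B) = emeasure lborel A * emeasure lborel B"
    unfolding lborel_prod [symmetric]
    using assms by (intro lborel.emeasure_pair_measure_Times) auto
  show "emeasure lborel (A \<times> B) < \<infinity>"
    unfolding e using assms by (simp add: ennreal_mult_less_top)
  show "measure lborel (A \<times> B) = measure lborel A * measure lborel B"
    unfolding measure_def e by (simp add: enn2real_mult)
qed

lemma emeasure_Int_unit:
  fixes A :: "real set"
  assumes "A \<in> sets borel" "A \<subseteq> {0..1}" "C \<in> sets borel"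
  shows "emeasure lborel (A \<inter> C) < \<infinity>" "measure lborel (A \<inter> C) \<le> 1"
proof -
  have "emeasure lborel (A \<inter> C) \<le> emeasure lborel {0..1 :: real}"
    using assms by (intro emeasure_mono) auto
  then have le: "emeasure lborel (A \<inter> C) \<le> 1" by simp
  then show "emeasure lborel (A \<inter> C) < \<infinity>"
    using le_less_trans by fastforce
  show "measure lborel (A \<inter> C) \<le> 1"
    unfolding measure_def using le enn2real_mono by fastforce
qed

lemma block_int_borel [measurable]: "block_int n i \<in> sets borel"
  by (simp add: block_int_def)

lemma measure_Int_block_int:
  assumes "A \<in> sets borel" "n > 0"
  shows "real n * measure lborel (A \<inter> block_int n i) \<le> 1"
proof -
  have "measure lborel (A \<inter> block_int n i) \<le> measure lborel (block_int n i)"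
    using assms by (intro measure_mono_fmeasurable) (auto simp: block_int_def intro!: fmeasurableI emeasure_bounded_finite)
  also have "\<dots> = 1 / real n"
    using \<open>n > 0\<close> by (simp add: block_int_def field_simps)
  finally show ?thesis
    using \<open>n > 0\<close> by (simp add: field_simps)
qed

lemma matrix_kernel_borel [measurable]: "matrix_kernel n x \<in> borel_measurable borel"
  unfolding matrix_kernel_def borel_prod [symmetric] by measurable

lemma matrix_kernel_diff:
  "matrix_kernel n x p - matrix_kernel n z p
    = matrix_kernel n (\<lambda>i. x i - z i) p"
  unfolding matrix_kernel_def sym_entry_def
  by (auto simp: sum_subtractf [symmetric] algebra_simps split: prod.split intro!: sum.cong)

lemma indicator_matrix_kernel:
  "indicator (A \<times> B) p *\<^sub>R matrix_kernel n x p
    = (\<Sum>i<n. \<Sum>j<n. sym_entry x i j * indicator ((A \<inter> block_int n i) \<times> (B \<inter> block_int n j)) p)"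
  unfolding matrix_kernel_def
  by (cases p) (simp add: sum_distrib_left indicator_times indicator_inter_arith mult_ac)

text \<open>Every block rectangle is integrated separately, so the formula is exact although closed
  blocks share end points. The result is bilinear in the measures of the pieces of \<open>A\<close>
  and \<open>B\<close>.\<close>

lemma matrix_kernel_rectangle:
  assumes A: "A \<in> sets borel" "A \<subseteq> {0..1}" and B: "B \<in> sets borel" "B \<subseteq> {0..1}"
  shows "set_integrable lebesgue (A \<times> B) (matrix_kernel n x)"
    and "(LINT p:(A \<times> B)|lebesgue. matrix_kernel n x p)
      = (\<Sum>i<n. \<Sum>j<n. sym_entry x i j *
          (measure lborel (A \<inter> block_int n i) * measure lborel (B \<inter> block_int n j)))"
proof -
  note m = measure_lborel_Times [of "A \<inter> block_int n i" "B \<inter> block_int n j" for i j]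
  note e = emeasure_Int_unit(1) [OF A] emeasure_Int_unit(1) [OF B]
  have [measurable]: "(A \<inter> block_int n i) \<times> (B \<inter> block_int n j) \<in> sets borel" for i j
    using A B by (intro m e) auto
  have fin: "emeasure lborel ((A \<inter> block_int n i) \<times> (B \<inter> block_int n j)) < \<infinity>" for i j
    using A B by (intro m e) auto
  have meas: "measure lborel ((A \<inter> block_int n i) \<times> (B \<inter> block_int n j))
      = measure lborel (A \<inter> block_int n i) * measure lborel (B \<inter> block_int n j)" for i j
    using A B by (intro m e) auto
  have int: "integrable lborel
      (indicator ((A \<inter> block_int n i) \<times> (B \<inter> block_int n j)) :: real \<times> real \<Rightarrow> real)" for i j
    using fin by (intro integrable_real_indicator) auto
  have i: "integrable lborel (\<lambda>p. indicator (A \<times> B) p *\<^sub>R matrix_kernel n x p)"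
    unfolding indicator_matrix_kernel
    by (intro Bochner_Integration.integrable_sum integrable_mult_right int)
  then show "set_integrable lebesgue (A \<times> B) (matrix_kernel n x)"
    unfolding set_integrable_def by (rule integrable_completion [THEN iffD2, OF borel_measurable_integrable [OF i]])
  have "(LINT p:(A \<times> B)|lebesgue. matrix_kernel n x p)
      = (\<integral>p. indicator (A \<times> B) p *\<^sub>R matrix_kernel n x p \<partial>lborel)"
    unfolding set_lebesgue_integral_def indicator_matrix_kernel
    by (intro integral_completion borel_measurable_integrable i [unfolded indicator_matrix_kernel])
  also have "\<dots> = (\<Sum>i<n. \<integral>p. (\<Sum>j<n. sym_entry x i j *
      indicator ((A \<inter> block_int n i) \<times> (B \<inter> block_int n j)) p) \<partial>lborel)"
    unfolding indicator_matrix_kernel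
    by (intro Bochner_Integration.integral_sum Bochner_Integration.integrable_sum
        integrable_mult_right int)
  also have "\<dots> = (\<Sum>i<n. \<Sum>j<n. \<integral>p. sym_entry x i j *
      indicator ((A \<inter> block_int n i) \<times> (B \<inter> block_int n j)) p \<partial>lborel)"
    by (intro sum.cong refl Bochner_Integration.integral_sum integrable_mult_right int)
  also have "\<dots> = (\<Sum>i<n. \<Sum>j<n. sym_entry x i j *
      measure lborel ((A \<inter> block_int n i) \<times> (B \<inter> block_int n j)))"
    using int by (intro sum.cong refl) simp
  finally show "(LINT p:(A \<times> B)|lebesgue. matrix_kernel n x p)
      = (\<Sum>i<n. \<Sum>j<n. sym_entry x i j *
          (measure lborel (A \<inter> block_int n i) * measure lborel (B \<inter> block_int n j)))"
    by (simp add: meas)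
qed

lemma matrix_kernel_rectangle_le:
  assumes A: "A \<in> sets borel" "A \<subseteq> {0..1}" and B: "B \<in> sets borel" "B \<subseteq> {0..1}"
    and T: "\<And>A B. A \<subseteq> {..<n} \<Longrightarrow> B \<subseteq> {..<n} \<Longrightarrow> \<bar>\<Sum>i\<in>A. \<Sum>j\<in>B. sym_entry x i j\<bar> \<le> T"
    and n: "n > 0"
  shows "\<bar>LINT p:(A \<times> B)|lebesgue. matrix_kernel n x p\<bar> \<le> T / (real n)\<^sup>2"
proof -
  \<comment> \<open>\<open>a i\<close> is the fraction of the \<open>i\<close>-th block covered by
    \<open>A\<close>, and \<open>b i\<close> that covered by \<open>B\<close>. Both lie in [0, 1],
    so the vertex bound applies to the entries and to their negatives.\<close>
  define a where "a i = real n * measure lborel (A \<inter> block_int n i)" for i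
  define b where "b i = real n * measure lborel (B \<inter> block_int n i)" for i
  have a: "0 \<le> a i \<and> a i \<le> 1" for i
    unfolding a_def using measure_Int_block_int [OF A(1) n] by simp
  have b: "0 \<le> b i \<and> b i \<le> 1" for i
    unfolding b_def using measure_Int_block_int [OF B(1) n] by simp
  have eq: "(LINT p:(A \<times> B)|lebesgue. matrix_kernel n x p)
      = (\<Sum>i<n. \<Sum>j<n. sym_entry x i j * (a i * b j)) / (real n)\<^sup>2"
    unfolding matrix_kernel_rectangle [OF A B] sum_divide_distrib
    using n by (simp add: a_def b_def power2_eq_square)
  have "(\<Sum>i<n. \<Sum>j<n. sym_entry x i j * (a i * b j)) \<le> T"
    by (rule bilinear_sum_le_vertices [OF _ a b]) (use T abs_le_D1 in blast)
  moreover have "(\<Sum>i<n. \<Sum>j<n. (- sym_entry x i j) * (a i * b j)) \<le> T"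
    by (rule bilinear_sum_le_vertices [OF _ a b]) (simp add: sum_negf, use T abs_le_D2 in blast)
  ultimately have "\<bar>\<Sum>i<n. \<Sum>j<n. sym_entry x i j * (a i * b j)\<bar> \<le> T"
    by (simp add: sum_negf)
  then show ?thesis
    unfolding eq by (simp add: divide_right_mono)
qed

text \<open>A crude bound, each piece having measure at most 1; it yields continuity of the cut
  distance in the entries.\<close>

lemma matrix_kernel_rectangle_Lipschitz:
  assumes A: "A \<in> sets borel" "A \<subseteq> {0..1}" and B: "B \<in> sets borel" "B \<subseteq> {0..1}"
  shows "\<bar>LINT p:(A \<times> B)|lebesgue. matrix_kernel n x p\<bar> \<le> (\<Sum>i<n. \<Sum>j<n. \<bar>sym_entry x i j\<bar>)"
proof -
  have "\<bar>sym_entry x i j * (measure lborel (A \<inter> block_int n i) * measure lborel (B \<inter> block_int n j))\<bar>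
      \<le> \<bar>sym_entry x i j\<bar>" for i j
    using emeasure_Int_unit(2) [OF A block_int_borel] emeasure_Int_unit(2) [OF B block_int_borel]
    by (simp add: abs_mult mult_left_le mult_le_one)
  then show ?thesis
    unfolding matrix_kernel_rectangle [OF A B]
    by (intro order_trans [OF sum_abs] sum_mono order_trans [OF sum_abs]) auto
qed

text \<open>In \<^const>\<open>cut_dist\<close> the supremum is over a set of reals, hence meaningful only when bounded;
  integrability of the kernels on the square provides this.\<close>

lemma rectangle_integral_le:
  fixes g :: "real \<times> real \<Rightarrow> real"
  assumes g: "set_integrable lebesgue unit_sq g"
    and A: "A \<in> sets borel" "A \<subseteq> {0..1}" and B: "B \<in> sets borel" "B \<subseteq> {0..1}"
  shows "set_integrable lebesgue (A \<times> B) g"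
    and "\<bar>LINT p:(A \<times> B)|lebesgue. g p\<bar> \<le> (LINT p:unit_sq|lebesgue. \<bar>g p\<bar>)"
proof -
  have s: "A \<times> B \<in> sets lebesgue"
    using borel_Times [OF A(1) B(1)] by simp
  have sub: "A \<times> B \<subseteq> unit_sq"
    using A B by (auto simp: unit_sq_def)
  show i: "set_integrable lebesgue (A \<times> B) g"
    by (rule set_integrable_subset [OF g s sub])
  have "\<bar>LINT p:(A \<times> B)|lebesgue. g p\<bar> \<le> (LINT p:(A \<times> B)|lebesgue. \<bar>g p\<bar>)"
    using set_integral_norm_bound [OF i] by simp
  also have "\<dots> \<le> (LINT p:unit_sq|lebesgue. \<bar>g p\<bar>)"
    unfolding set_lebesgue_integral_def
    using set_integrable_abs [OF i] set_integrable_abs [OF g] sub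
    by (intro integral_mono) (auto simp: set_integrable_def indicator_def)
  finally show "\<bar>LINT p:(A \<times> B)|lebesgue. g p\<bar> \<le> (LINT p:unit_sq|lebesgue. \<bar>g p\<bar>)" .
qed

lemma set_integrable_matrix_kernel: "set_integrable lebesgue unit_sq (matrix_kernel n x)"
  unfolding unit_sq_def by (rule matrix_kernel_rectangle) auto

section \<open>The cut distance as a function of the matrix\<close>

lemma cut_dist_leI:
  assumes "\<And>A B. A \<in> sets borel \<Longrightarrow> B \<in> sets borel \<Longrightarrow> A \<subseteq> {0..1} \<Longrightarrow> B \<subseteq> {0..1} \<Longrightarrow>
    \<bar>LINT p:(A \<times> B)|lebesgue. (k1 p - k2 p)\<bar> \<le> c"
  shows "cut_dist k1 k2 \<le> c"
  unfolding cut_dist_def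
proof (rule cSUP_least)
  show "{(A, B). A \<in> sets borel \<and> B \<in> sets borel \<and> A \<subseteq> {0..1} \<and> B \<subseteq> {0..1 :: real}} \<noteq> {}"
    by (auto intro!: exI [of _ "{}"])
qed (use assms in auto)

text \<open>The kernel of \<open>x\<close> is the kernel of the difference plus that of
  \<open>z\<close>. The first form compares two matrices with the same target and gives continuity;
  the second replaces the remaining cut distance by an L1 distance and enters the probability
  estimate.\<close>

lemma cut_dist_triangle:
  assumes f: "set_integrable lebesgue unit_sq f"
    and D: "\<And>A B. A \<in> sets borel \<Longrightarrow> B \<in> sets borel \<Longrightarrow> A \<subseteq> {0..1} \<Longrightarrow> B \<subseteq> {0..1} \<Longrightarrow>
    \<bar>LINT p:(A \<times> B)|lebesgue. matrix_kernel n (\<lambda>i. x i - z i) p\<bar> \<le> D"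
  shows "cut_dist (matrix_kernel n x) f \<le> D + cut_dist (matrix_kernel n z) f"
    and "cut_dist (matrix_kernel n x) f
      \<le> D + (LINT p:unit_sq|lebesgue. \<bar>matrix_kernel n z p - f p\<bar>)"
proof -
  have iz: "set_integrable lebesgue unit_sq (\<lambda>p. matrix_kernel n z p - f p)"
    by (intro set_integral_diff set_integrable_matrix_kernel f)
  have le: "\<bar>LINT p:(A \<times> B)|lebesgue. (matrix_kernel n x p - f p)\<bar>
      \<le> D + \<bar>LINT p:(A \<times> B)|lebesgue. (matrix_kernel n z p - f p)\<bar>"
    if AB: "A \<in> sets borel" "A \<subseteq> {0..1}" "B \<in> sets borel" "B \<subseteq> {0..1}" for A B
  proof -
    have "(LINT p:(A \<times> B)|lebesgue. (matrix_kernel n x p - f p))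
        = (LINT p:(A \<times> B)|lebesgue. (matrix_kernel n (\<lambda>i. x i - z i) p + (matrix_kernel n z p - f p)))"
      by (simp add: matrix_kernel_diff [symmetric])
    also have "\<dots> = (LINT p:(A \<times> B)|lebesgue. matrix_kernel n (\<lambda>i. x i - z i) p)
        + (LINT p:(A \<times> B)|lebesgue. (matrix_kernel n z p - f p))"
      by (intro set_integral_add rectangle_integral_le(1) [OF iz]
          rectangle_integral_le(1) [OF set_integrable_matrix_kernel]) (use AB in auto)
    finally show ?thesis
      using D [OF AB(1,3,2,4)] by linarith
  qed
  show "cut_dist (matrix_kernel n x) f
      \<le> D + (LINT p:unit_sq|lebesgue. \<bar>matrix_kernel n z p - f p\<bar>)"
    by (rule cut_dist_leI, rule order_trans [OF le])
       (auto intro!: rectangle_integral_le(2) [OF iz])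
  have "\<bar>LINT p:(A \<times> B)|lebesgue. (matrix_kernel n z p - f p)\<bar> \<le> cut_dist (matrix_kernel n z) f"
    if AB: "A \<in> sets borel" "A \<subseteq> {0..1}" "B \<in> sets borel" "B \<subseteq> {0..1}" for A B
    unfolding cut_dist_def
  proof (rule order_trans [OF _ cSUP_upper [of "(A, B)"]])
    show "bdd_above ((\<lambda>AB. \<bar>LINT p:fst AB \<times> snd AB|lebesgue. matrix_kernel n z p - f p\<bar>) `
        {(A, B). A \<in> sets borel \<and> B \<in> sets borel \<and> A \<subseteq> {0..1} \<and> B \<subseteq> {0..1}})"
      by (rule bdd_aboveI2 [where M = "LINT p:unit_sq|lebesgue. \<bar>matrix_kernel n z p - f p\<bar>"])
         (auto intro!: rectangle_integral_le(2) [OF iz])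
  qed (use AB in auto)
  then show "cut_dist (matrix_kernel n x) f \<le> D + cut_dist (matrix_kernel n z) f"
    by (intro cut_dist_leI order_trans [OF le]) auto
qed

lemma cut_dist_matrix_kernel_le:
  assumes f: "set_integrable lebesgue unit_sq f" and n: "n > 0"
    and T: "\<And>A B. A \<subseteq> {..<n} \<Longrightarrow> B \<subseteq> {..<n} \<Longrightarrow>
      \<bar>\<Sum>i\<in>A. \<Sum>j\<in>B. sym_entry (\<lambda>i. x i - z i) i j\<bar> \<le> T"
  shows "cut_dist (matrix_kernel n x) f
    \<le> T / (real n)\<^sup>2 + (LINT p:unit_sq|lebesgue. \<bar>matrix_kernel n z p - f p\<bar>)"
  by (intro cut_dist_triangle(2) [OF f] matrix_kernel_rectangle_le T n)

lemma cut_dist_Lipschitz: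
  assumes f: "set_integrable lebesgue unit_sq f"
  shows "\<bar>cut_dist (matrix_kernel n x) f - cut_dist (matrix_kernel n z) f\<bar>
    \<le> (\<Sum>i<n. \<Sum>j<n. \<bar>sym_entry x i j - sym_entry z i j\<bar>)"
proof -
  have d: "sym_entry (\<lambda>i. x i - z i) i j = sym_entry x i j - sym_entry z i j" for x z i j
    by (simp add: sym_entry_def)
  have "cut_dist (matrix_kernel n x) f
      \<le> (\<Sum>i<n. \<Sum>j<n. \<bar>sym_entry x i j - sym_entry z i j\<bar>) + cut_dist (matrix_kernel n z) f" for x z
    unfolding d [symmetric]
    by (intro cut_dist_triangle(1) [OF f] matrix_kernel_rectangle_Lipschitz)
  from this [of x z] this [of z x] show ?thesis
    by (simp add: abs_minus_commute)
qed

text \<open>The event involves a supremum over uncountably many pairs of sets, and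
  \<open>measure\<close> returns 0 on non-measurable sets. By \<open>cut_dist_Lipschitz\<close> the
  distance is continuous in the entries, hence Borel.\<close>

lemma cut_ball_measurable:
  assumes f: "set_integrable lebesgue unit_sq f" and sets: "sets \<mu> = sets (borel :: real measure)"
  shows "{x \<in> space (entries_law \<mu> n). cut_dist (matrix_kernel n x) f < \<delta>} \<in> sets (entries_law \<mu> n)"
proof -
  note sets [measurable_cong]
  let ?F = "\<lambda>x. cut_dist (matrix_kernel n x) f"
  \<comment> \<open>On the product over all index pairs the product sigma algebra is the Borel one.
    Entries outside \<open>upper_idx n\<close> are set to 0, and \<open>matrix_kernel n\<close>
    never reads them.\<close>
  let ?e = "\<lambda>x i. if i \<in> upper_idx n then x i else (0 :: real)"
  have "continuous (at x) ?F" for x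
    unfolding continuous_at
  proof (rule LIM_zero_cancel, rule Lim_null_comparison)
    show "\<forall>\<^sub>F y in at x. norm (?F y - ?F x)
        \<le> (\<Sum>i<n. \<Sum>j<n. \<bar>sym_entry y i j - sym_entry x i j\<bar>)"
      using cut_dist_Lipschitz [OF f] by (intro always_eventually) simp
    have c: "((\<lambda>y. y i) \<longlongrightarrow> x i) (at x)" for i
      using continuous_on_product_coordinates [of i] by (metis UNIV_I continuous_on_def)
    have "((\<lambda>y. sym_entry y i j) \<longlongrightarrow> sym_entry x i j) (at x)" for i j
      by (simp add: sym_entry_def c)
    then show "((\<lambda>y. \<Sum>i<n. \<Sum>j<n. \<bar>sym_entry y i j - sym_entry x i j\<bar>) \<longlongrightarrow> 0) (at x)"
      by (intro tendsto_null_sum tendsto_rabs_zero LIM_zero)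
  qed
  then have "?F \<in> borel_measurable borel"
    by (intro borel_measurable_continuous_onI) (simp add: continuous_at_imp_continuous_on)
  then have 1: "?F \<in> borel_measurable (PiM UNIV (\<lambda>_. borel))"
    by (simp cong: measurable_cong_sets add: sets_PiM_equal_borel)
  have 2: "?e \<in> measurable (entries_law \<mu> n) (PiM UNIV (\<lambda>_. borel))"
    unfolding entries_law_def
  proof (rule measurable_PiM_single')
    show "(\<lambda>x. ?e x i) \<in> borel_measurable (PiM (upper_idx n) (\<lambda>_. \<mu>))" for i
      by (cases "i \<in> upper_idx n") auto
  qed auto
  have "sym_entry (?e x) i j = sym_entry x i j" if "i < n" "j < n" for x i j
    using that by (auto simp: sym_entry_def upper_idx_def)
  then have "matrix_kernel n (?e x) = matrix_kernel n x" for x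
    unfolding matrix_kernel_def by (intro ext) (auto intro!: sum.cong)
  then have "?F \<in> borel_measurable (entries_law \<mu> n)"
    using measurable_compose [OF 2 1] by simp
  then show ?thesis by measurable
qed

subsection \<open>Step kernels\<close>

text \<open>Half-open, so that the half-open grid cells partition it; it differs from
  \<open>unit_sq\<close> by a null set.\<close>

definition half_sq :: "(real \<times> real) set" where
  "half_sq = {0..<1} \<times> {0..<1}"

definition grid_idx :: "nat \<Rightarrow> real \<Rightarrow> nat" where
  "grid_idx m s = nat \<lfloor>real m * s\<rfloor>"

definition grid_cell :: "nat \<Rightarrow> nat \<Rightarrow> nat \<Rightarrow> (real \<times> real) set" where
  "grid_cell m i j = {real i / real m..<(real i + 1) / real m} \<times> {real j / real m..<(real j + 1) / real m}"

text \<open>Looking up the index of the cell makes pointwise comparisons of two step kernels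
  immediate; \<open>step_kernel_eq\<close> supplies the sum over cells for integration.\<close>

definition step_kernel :: "nat \<Rightarrow> (nat \<Rightarrow> nat \<Rightarrow> real) \<Rightarrow> real \<times> real \<Rightarrow> real" where
  "step_kernel m a p = indicator half_sq p * a (grid_idx m (fst p)) (grid_idx m (snd p))"

lemma half_sq_borel [measurable]: "half_sq \<in> sets borel"
  unfolding half_sq_def by (intro borel_Times) auto

lemma grid_cell_borel [measurable]: "grid_cell m i j \<in> sets borel"
  unfolding grid_cell_def by (intro borel_Times) auto

lemma grid_idx_less: "0 \<le> s \<Longrightarrow> s < 1 \<Longrightarrow> m > 0 \<Longrightarrow> grid_idx m s < m"
  unfolding grid_idx_def by (simp add: nat_less_iff floor_less_iff)

lemma grid_idx_eq_iff:
  assumes "0 \<le> s" "m > 0"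
  shows "grid_idx m s = i \<longleftrightarrow> real i / real m \<le> s \<and> s < (real i + 1) / real m"
proof -
  have "grid_idx m s = i \<longleftrightarrow> \<lfloor>real m * s\<rfloor> = int i"
    unfolding grid_idx_def using assms by (auto simp: nat_eq_iff)
  also have "\<dots> \<longleftrightarrow> real i / real m \<le> s \<and> s < (real i + 1) / real m"
    using assms by (simp add: floor_eq_iff field_simps)
  finally show ?thesis .
qed

lemma mem_grid_cell_iff:
  assumes "m > 0" "i < m" "j < m"
  shows "p \<in> grid_cell m i j \<longleftrightarrow> p \<in> half_sq \<and> grid_idx m (fst p) = i \<and> grid_idx m (snd p) = j"
proof -
  have *: "s \<in> {real k / real m..<(real k + 1) / real m} \<longleftrightarrow> 0 \<le> s \<and> s < 1 \<and> grid_idx m s = k"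
    if "k < m" for k s
  proof -
    have "s \<ge> 0" if "real k / real m \<le> s"
      by (rule order_trans [OF _ that]) simp
    moreover have "(real k + 1) / real m \<le> 1"
      using that by (simp add: field_simps)
    ultimately show ?thesis
      using grid_idx_eq_iff [OF _ \<open>m > 0\<close>, of s k] by auto
  qed
  show ?thesis
    using *[OF assms(2)] *[OF assms(3)]
    by (cases p) (auto simp: grid_cell_def half_sq_def)
qed

text \<open>Exactly one cell contains a given point of \<open>half_sq\<close>. The semiring is left
  open because both real and \<open>ennreal\<close> integrands are decomposed this way.\<close>

lemma sum_grid_cells:
  fixes F :: "nat \<Rightarrow> nat \<Rightarrow> 'a :: comm_semiring_1"
  assumes "m > 0"
  shows "(\<Sum>i<m. \<Sum>j<m. F i j * indicator (grid_cell m i j) p)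
    = F (grid_idx m (fst p)) (grid_idx m (snd p)) * indicator half_sq p"
proof (cases "p \<in> half_sq")
  case True
  then have less: "grid_idx m (fst p) < m" "grid_idx m (snd p) < m"
    using grid_idx_less assms by (auto simp: half_sq_def)
  have "(\<Sum>i<m. \<Sum>j<m. F i j * indicator (grid_cell m i j) p)
      = (\<Sum>i<m. \<Sum>j<m. if i = grid_idx m (fst p) then if j = grid_idx m (snd p) then F i j else 0 else 0)"
    using True assms by (intro sum.cong refl) (auto simp: mem_grid_cell_iff indicator_def)
  also have "\<dots> = (\<Sum>i<m. if i = grid_idx m (fst p) then F i (grid_idx m (snd p)) else 0)"
    using less by (intro sum.cong refl) (auto simp: sum.delta')
  also have "\<dots> = F (grid_idx m (fst p)) (grid_idx m (snd p))"
    using less by (simp add: sum.delta')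
  finally show ?thesis using True by simp
next
  case False
  then have "(\<Sum>i<m. \<Sum>j<m. F i j * indicator (grid_cell m i j) p) = 0"
    using assms by (intro sum.neutral ballI) (auto simp: mem_grid_cell_iff indicator_def)
  then show ?thesis using False by simp
qed

lemma emeasure_grid_cell:
  assumes "m > 0"
  shows "emeasure lborel (grid_cell m i j) < \<infinity>" "measure lborel (grid_cell m i j) = 1 / (real m)\<^sup>2"
proof -
  have e: "emeasure lborel {real i / real m..<(real i + 1) / real m} = ennreal (1 / real m)" for i
    using assms by (subst emeasure_lborel_Ico) (auto simp: divide_right_mono diff_divide_distrib [symmetric])
  have "emeasure lborel (grid_cell m i j) = ennreal (1 / real m) * ennreal (1 / real m)"
    unfolding grid_cell_def lborel_prod [symmetric]
    by (subst lborel.emeasure_pair_measure_Times) (auto simp: e)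
  also have "\<dots> = ennreal (1 / (real m)\<^sup>2)"
    by (simp add: ennreal_mult [symmetric] power2_eq_square)
  finally show "emeasure lborel (grid_cell m i j) < \<infinity>" "measure lborel (grid_cell m i j) = 1 / (real m)\<^sup>2"
    by (auto simp: measure_def)
qed

lemma integrable_grid_cell: "m > 0 \<Longrightarrow> integrable lborel (indicator (grid_cell m i j) :: _ \<Rightarrow> real)"
  using emeasure_grid_cell by (intro integrable_real_indicator) auto

lemma step_kernel_eq:
  "m > 0 \<Longrightarrow> step_kernel m a = (\<lambda>p. \<Sum>i<m. \<Sum>j<m. a i j * indicator (grid_cell m i j) p)"
  by (intro ext, subst sum_grid_cells) (auto simp: step_kernel_def)

lemma
  assumes "m > 0"
  shows integrable_step_kernel: "integrable lborel (step_kernel m a)"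
    and integral_step_kernel: "(\<integral>p. step_kernel m a p \<partial>lborel) = (\<Sum>i<m. \<Sum>j<m. a i j) / (real m)\<^sup>2"
proof -
  note i = integrable_mult_right [OF integrable_grid_cell [OF assms]]
  show "integrable lborel (step_kernel m a)"
    unfolding step_kernel_eq [OF assms]
    by (intro Bochner_Integration.integrable_sum i)
  have "(\<integral>p. step_kernel m a p \<partial>lborel)
      = (\<Sum>i<m. \<integral>p. (\<Sum>j<m. a i j * indicator (grid_cell m i j) p) \<partial>lborel)"
    unfolding step_kernel_eq [OF assms]
    by (intro Bochner_Integration.integral_sum Bochner_Integration.integrable_sum i)
  also have "\<dots> = (\<Sum>i<m. \<Sum>j<m. \<integral>p. a i j * indicator (grid_cell m i j) p \<partial>lborel)"
    by (intro sum.cong refl Bochner_Integration.integral_sum i)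
  also have "\<dots> = (\<Sum>i<m. \<Sum>j<m. a i j / (real m)\<^sup>2)"
    using emeasure_grid_cell(2) [OF assms] integrable_grid_cell [OF assms]
    by (intro sum.cong refl) simp
  finally show "(\<integral>p. step_kernel m a p \<partial>lborel) = (\<Sum>i<m. \<Sum>j<m. a i j) / (real m)\<^sup>2"
    by (simp add: sum_divide_distrib)
qed

lemma step_kernel_borel [measurable]: "step_kernel m a \<in> borel_measurable borel"
proof (cases "m = 0")
  case True
  then have "step_kernel m a = (\<lambda>p. indicator half_sq p * a 0 0)"
    by (auto simp: step_kernel_def grid_idx_def)
  then show ?thesis by simp
next
  case False
  then show ?thesis
    using borel_measurable_integrable [OF integrable_step_kernel [of m a]] by simp
qed

definition cell_avg :: "nat \<Rightarrow> (real \<times> real \<Rightarrow> real) \<Rightarrow> nat \<Rightarrow> nat \<Rightarrow> real" where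
  "cell_avg m g i j = (real m)\<^sup>2 * (\<integral>p. g p * indicator (grid_cell m i j) p \<partial>lborel)"

lemma cell_avg_commute:
  assumes [measurable]: "g \<in> borel_measurable borel" and sym: "\<And>x y. g (x, y) = g (y, x)"
  shows "cell_avg m g i j = cell_avg m g j i"
proof -
  let ?F = "\<lambda>p. g p * indicator (grid_cell m i j) p"
  have "?F \<in> borel_measurable (lborel \<Otimes>\<^sub>M lborel)"
    unfolding lborel_prod by simp
  from lborel_pair.integral_product_swap [OF this]
  have "(\<integral>p. ?F p \<partial>lborel) = (\<integral>p. (case p of (x, y) \<Rightarrow> ?F (y, x)) \<partial>lborel)"
    unfolding lborel_prod by simp
  also have "(\<lambda>p. (case p of (x, y) \<Rightarrow> ?F (y, x))) = (\<lambda>p. g p * indicator (grid_cell m j i) p)"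
    using sym by (auto simp: grid_cell_def indicator_def fun_eq_iff)
  finally show ?thesis by (simp add: cell_avg_def)
qed

text \<open>Averaging over cells fixes step kernels and does not increase the L1 norm: on each cell
  the difference of \<open>s\<close> and the average is, up to the area, the integral of s -
  g.\<close>

lemma cell_avg_contraction:
  assumes g: "integrable lborel g" and m: "m > 0"
  shows "(\<integral>p. \<bar>step_kernel m s p - step_kernel m (cell_avg m g) p\<bar> \<partial>lborel)
    \<le> (\<integral>p. \<bar>g p - step_kernel m s p\<bar> \<partial>lborel)"
proof -
  let ?D = "\<lambda>p. \<bar>g p - step_kernel m s p\<bar>"
  have D: "integrable lborel ?D"
    using g integrable_step_kernel [OF m] by auto
  have DI: "integrable lborel (\<lambda>p. ?D p * indicator (grid_cell m i j) p)" for i j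
    using integrable_mult_indicator [OF _ D, of "grid_cell m i j"] by (simp add: mult.commute)
  have gI: "integrable lborel (\<lambda>p. g p * indicator (grid_cell m i j) p)" for i j
    using integrable_mult_indicator [OF _ g, of "grid_cell m i j"] by (simp add: mult.commute)
  have cell: "\<bar>s i j - cell_avg m g i j\<bar> / (real m)\<^sup>2
      \<le> (\<integral>p. ?D p * indicator (grid_cell m i j) p \<partial>lborel)" if "i < m" "j < m" for i j
  proof -
    have "(s i j - cell_avg m g i j) / (real m)\<^sup>2
        = (\<integral>p. s i j * indicator (grid_cell m i j) p - g p * indicator (grid_cell m i j) p \<partial>lborel)"
      using m gI integrable_grid_cell [OF m] emeasure_grid_cell(2) [OF m]
      by (subst Bochner_Integration.integral_diff) (auto simp: cell_avg_def field_simps)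
    then have "\<bar>s i j - cell_avg m g i j\<bar> / (real m)\<^sup>2
        = \<bar>\<integral>p. s i j * indicator (grid_cell m i j) p - g p * indicator (grid_cell m i j) p \<partial>lborel\<bar>"
      by (metis abs_divide abs_power2)
    also have "\<dots> \<le> (\<integral>p. \<bar>s i j * indicator (grid_cell m i j) p - g p * indicator (grid_cell m i j) p\<bar> \<partial>lborel)"
      by (rule integral_abs_bound)
    also have "\<dots> = (\<integral>p. ?D p * indicator (grid_cell m i j) p \<partial>lborel)"
      using that m
      by (intro Bochner_Integration.integral_cong refl)
         (auto simp: step_kernel_def mem_grid_cell_iff indicator_def abs_minus_commute)
    finally show ?thesis .
  qed
  have "(\<integral>p. \<bar>step_kernel m s p - step_kernel m (cell_avg m g) p\<bar> \<partial>lborel)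
      = (\<integral>p. step_kernel m (\<lambda>i j. \<bar>s i j - cell_avg m g i j\<bar>) p \<partial>lborel)"
    by (intro Bochner_Integration.integral_cong refl) (auto simp: step_kernel_def indicator_def)
  also have "\<dots> = (\<Sum>i<m. \<Sum>j<m. \<bar>s i j - cell_avg m g i j\<bar> / (real m)\<^sup>2)"
    by (simp add: integral_step_kernel [OF m] sum_divide_distrib)
  also have "\<dots> \<le> (\<Sum>i<m. \<Sum>j<m. \<integral>p. ?D p * indicator (grid_cell m i j) p \<partial>lborel)"
    by (intro sum_mono cell) auto
  also have "\<dots> = (\<Sum>i<m. \<integral>p. (\<Sum>j<m. ?D p * indicator (grid_cell m i j) p) \<partial>lborel)"
    by (intro sum.cong refl Bochner_Integration.integral_sum [symmetric] DI)
  also have "\<dots> = (\<integral>p. (\<Sum>i<m. \<Sum>j<m. ?D p * indicator (grid_cell m i j) p) \<partial>lborel)"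
    by (intro Bochner_Integration.integral_sum [symmetric] Bochner_Integration.integrable_sum DI)
  also have "\<dots> = (\<integral>p. ?D p * indicator half_sq p \<partial>lborel)"
    by (simp only: sum_grid_cells [OF m])
  also have "\<dots> \<le> (\<integral>p. ?D p \<partial>lborel)"
    using integrable_mult_indicator [OF _ D, of half_sq] D
    by (intro integral_mono) (auto simp: mult.commute indicator_def)
  finally show ?thesis .
qed

lemma integrable_half_sq: "integrable lborel (indicator half_sq :: _ \<Rightarrow> real)"
  using integrable_step_kernel [of 1 "\<lambda>_ _. 1"] by (simp add: step_kernel_def [abs_def])

lemma grid_idx_tendsto: "0 \<le> s \<Longrightarrow> (\<lambda>m. real (grid_idx (Suc m) s) / real (Suc m)) \<longlonglongrightarrow> s"
proof (rule LIM_zero_cancel, rule Lim_null_comparison)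
  assume s: "0 \<le> s"
  show "\<forall>\<^sub>F m in sequentially. norm (real (grid_idx (Suc m) s) / real (Suc m) - s) \<le> inverse (real (Suc m))"
  proof (intro always_eventually allI)
    fix m
    have "real (grid_idx (Suc m) s) / real (Suc m) \<le> s \<and> s < (real (grid_idx (Suc m) s) + 1) / real (Suc m)"
      using grid_idx_eq_iff [OF s, of "Suc m"] by blast
    then show "norm (real (grid_idx (Suc m) s) / real (Suc m) - s) \<le> inverse (real (Suc m))"
      unfolding add_divide_distrib by (auto simp: inverse_eq_divide)
  qed
  show "(\<lambda>m. inverse (real (Suc m))) \<longlonglongrightarrow> 0"
    by (rule LIMSEQ_inverse_real_of_nat)
qed

text \<open>\<phi> is sampled at the lower left corner of each cell. The corner converges to the
  point as the grid is refined, and the constant 2 R on the square is a majorant.\<close>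

lemma step_approx_continuous:
  fixes \<phi> :: "real \<times> real \<Rightarrow> real"
  assumes cont: "continuous_on UNIV \<phi>" and bnd: "\<And>p. \<bar>\<phi> p\<bar> \<le> R" and "e > 0"
  obtains m s where "m > 0" "(\<integral>p. \<bar>\<phi> p * indicator half_sq p - step_kernel m s p\<bar> \<partial>lborel) < e"
proof -
  have [measurable]: "\<phi> \<in> borel_measurable borel"
    using cont by (rule borel_measurable_continuous_onI)
  have isCont: "isCont \<phi> p" for p
    using cont continuous_on_eq_continuous_at [OF open_UNIV] by blast
  define s where "s m i j = \<phi> (real i / real (Suc m), real j / real (Suc m))" for m i j
  let ?F = "\<lambda>m p. \<bar>\<phi> p * indicator half_sq p - step_kernel (Suc m) (s m) p\<bar>"
  have "(\<lambda>m. \<integral>p. ?F m p \<partial>lborel) \<longlonglongrightarrow> (\<integral>p. (0 :: real) \<partial>(lborel :: (real \<times> real) measure))"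
  proof (rule integral_dominated_convergence [where w = "\<lambda>p. 2 * R * indicator half_sq p"])
    show "integrable lborel (\<lambda>p. 2 * R * indicator half_sq p)"
      using integrable_half_sq by simp
    show "AE p in lborel. (\<lambda>m. ?F m p) \<longlonglongrightarrow> 0"
    proof (intro AE_I2)
      fix p :: "real \<times> real"
      show "(\<lambda>m. ?F m p) \<longlonglongrightarrow> 0"
      proof (cases "p \<in> half_sq")
        case True
        then have "0 \<le> fst p" "0 \<le> snd p" by (auto simp: half_sq_def)
        then have "(\<lambda>m. (real (grid_idx (Suc m) (fst p)) / real (Suc m),
            real (grid_idx (Suc m) (snd p)) / real (Suc m))) \<longlonglongrightarrow> (fst p, snd p)"
          by (intro tendsto_Pair grid_idx_tendsto)
        then have "(\<lambda>m. \<phi> (real (grid_idx (Suc m) (fst p)) / real (Suc m),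
            real (grid_idx (Suc m) (snd p)) / real (Suc m))) \<longlonglongrightarrow> \<phi> (fst p, snd p)"
          by (intro isCont_tendsto_compose [OF isCont])
        then have "(\<lambda>m. \<bar>\<phi> p - \<phi> (real (grid_idx (Suc m) (fst p)) / real (Suc m),
            real (grid_idx (Suc m) (snd p)) / real (Suc m))\<bar>) \<longlonglongrightarrow> \<bar>\<phi> p - \<phi> p\<bar>"
          by (intro tendsto_intros) simp
        then show ?thesis using True by (simp add: step_kernel_def s_def)
      qed (simp add: step_kernel_def)
    qed
    show "AE p in lborel. norm (?F m p) \<le> 2 * R * indicator half_sq p" for m
    proof (intro AE_I2)
      fix p
      show "norm (?F m p) \<le> 2 * R * indicator half_sq p"
        using bnd [of p] bnd [of "(real (grid_idx (Suc m) (fst p)) / real (Suc m),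
            real (grid_idx (Suc m) (snd p)) / real (Suc m))"]
        by (auto simp: step_kernel_def s_def indicator_def)
    qed
  qed auto
  then have "\<forall>\<^sub>F m in sequentially. (\<integral>p. ?F m p \<partial>lborel) < e"
    using \<open>e > 0\<close> by (intro order_tendstoD(2)) auto
  then obtain m where "(\<integral>p. ?F m p \<partial>lborel) < e"
    by (auto simp: eventually_sequentially)
  then show ?thesis using that [of "Suc m" "s m"] by simp
qed

section \<open>Density of step kernels in L1\<close>

definition clamp_real :: "real \<Rightarrow> real \<Rightarrow> real" where
  "clamp_real R x = max (- R) (min R x)"

lemma clamp_real_borel [measurable]: "clamp_real R \<in> borel_measurable borel"
  unfolding clamp_real_def by measurable

text \<open>Three errors of e / 3 add up: cutting \<open>g\<close> off at height k, replacing the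
  bounded function by a continuous one, and sampling the latter on a grid.\<close>

lemma step_approx_integrable:
  fixes g :: "real \<times> real \<Rightarrow> real"
  assumes g: "integrable lborel g" and off: "\<And>p. p \<notin> half_sq \<Longrightarrow> g p = 0" and "e > 0"
  obtains m s where "m > 0" "(\<integral>p. \<bar>g p - step_kernel m s p\<bar> \<partial>lborel) < e"
proof -
  have [measurable]: "g \<in> borel_measurable borel"
    using borel_measurable_integrable [OF g] by simp
  have "(\<lambda>k. \<integral>p. \<bar>g p - clamp_real (real k) (g p)\<bar> \<partial>lborel) \<longlonglongrightarrow> (\<integral>p. (0 :: real) \<partial>(lborel :: (real \<times> real) measure))"
  proof (rule integral_dominated_convergence [where w = "\<lambda>p. \<bar>g p\<bar>"])
    show "AE p in lborel. (\<lambda>k. \<bar>g p - clamp_real (real k) (g p)\<bar>) \<longlonglongrightarrow> 0"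
    proof (intro AE_I2 tendsto_eventually)
      fix p
      show "\<forall>\<^sub>F k in sequentially. \<bar>g p - clamp_real (real k) (g p)\<bar> = 0"
        using eventually_ge_at_top [of "nat \<lceil>\<bar>g p\<bar>\<rceil>"]
        by eventually_elim (auto simp: clamp_real_def max_def min_def)
    qed
  qed (use g in \<open>auto simp: clamp_real_def\<close>)
  then have "\<forall>\<^sub>F k in sequentially. (\<integral>p. \<bar>g p - clamp_real (real k) (g p)\<bar> \<partial>lborel) < e / 3"
    using \<open>e > 0\<close> by (intro order_tendstoD(2)) auto
  then obtain k where k: "(\<integral>p. \<bar>g p - clamp_real (real k) (g p)\<bar> \<partial>lborel) < e / 3"
    by (auto simp: eventually_sequentially)
  define g' where "g' p = clamp_real (real k) (g p)" for p
  have [measurable]: "g' \<in> borel_measurable borel"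
    unfolding g'_def by measurable
  have g': "\<bar>g' p\<bar> \<le> real k" "\<bar>g' p\<bar> \<le> \<bar>g p\<bar>" "p \<notin> half_sq \<Longrightarrow> g' p = 0" for p
    using off by (auto simp: g'_def clamp_real_def)
  have g'_int: "integrable lborel g'"
    by (rule Bochner_Integration.integrable_bound [OF g]) (use g' in auto)
  have "g' \<in> borel_measurable lebesgue"
    by (simp add: measurable_completion)
  then have "g' measurable_on UNIV"
    by (rule lebesgue_measurable_imp_measurable_on_real) simp
  then obtain N \<phi> where N: "negligible N" and \<phi>: "\<And>n. continuous_on UNIV (\<phi> n)"
    and lim: "\<And>p. p \<notin> N \<Longrightarrow> (\<lambda>n. \<phi> n p) \<longlonglongrightarrow> g' p"
    by (auto simp: measurable_on_def)
  \<comment> \<open>The continuous functions converging to \<open>g'\<close> may be unbounded.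
    Clamping them at k keeps continuity, keeps the limit because \<open>g'\<close> is bounded by k,
    and provides a majorant.\<close>
  define \<psi> where "\<psi> n p = clamp_real (real k) (\<phi> n p)" for n p
  have \<psi>: "continuous_on UNIV (\<psi> n)" "\<bar>\<psi> n p\<bar> \<le> real k" for n p
    unfolding \<psi>_def clamp_real_def by (intro continuous_intros \<phi>) auto
  have [measurable]: "\<psi> n \<in> borel_measurable borel" for n
    using \<psi>(1) by (rule borel_measurable_continuous_onI)
  have "(\<lambda>n. \<integral>p. \<bar>g' p - \<psi> n p * indicator half_sq p\<bar> \<partial>lborel)
      \<longlonglongrightarrow> (\<integral>p. (0 :: real) \<partial>(lborel :: (real \<times> real) measure))"
  proof (rule integral_dominated_convergence [where w = "\<lambda>p. 2 * real k * indicator half_sq p"])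
    show "integrable lborel (\<lambda>p. 2 * real k * indicator half_sq p)"
      using integrable_half_sq by simp
    have "AE p in lebesgue. p \<notin> N"
      using N by (intro AE_not_in) (simp add: negligible_iff_null_sets)
    then have "AE p in lborel. p \<notin> N"
      by (simp add: AE_completion_iff)
    then show "AE p in lborel. (\<lambda>n. \<bar>g' p - \<psi> n p * indicator half_sq p\<bar>) \<longlonglongrightarrow> 0"
    proof eventually_elim
      case (elim p)
      have "(\<lambda>n. \<psi> n p) \<longlonglongrightarrow> clamp_real (real k) (g' p)"
        unfolding \<psi>_def clamp_real_def using lim [OF elim] by (intro tendsto_intros)
      also have "clamp_real (real k) (g' p) = g' p"
        using g'(1) [of p] by (auto simp: clamp_real_def)
      finally have "(\<lambda>n. \<bar>g' p - \<psi> n p\<bar>) \<longlonglongrightarrow> \<bar>g' p - g' p\<bar>"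
        by (intro tendsto_intros)
      then show ?case using g'(3) [of p] by (cases "p \<in> half_sq") auto
    qed
    show "AE p in lborel. norm \<bar>g' p - \<psi> n p * indicator half_sq p\<bar> \<le> 2 * real k * indicator half_sq p" for n
    proof (intro AE_I2)
      fix p
      show "norm \<bar>g' p - \<psi> n p * indicator half_sq p\<bar> \<le> 2 * real k * indicator half_sq p"
        using g'(1,3) [of p] \<psi>(2) [of n p] by (cases "p \<in> half_sq") auto
    qed
  qed auto
  then have "\<forall>\<^sub>F n in sequentially. (\<integral>p. \<bar>g' p - \<psi> n p * indicator half_sq p\<bar> \<partial>lborel) < e / 3"
    using \<open>e > 0\<close> by (intro order_tendstoD(2)) auto
  then obtain n where n: "(\<integral>p. \<bar>g' p - \<psi> n p * indicator half_sq p\<bar> \<partial>lborel) < e / 3"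
    by (auto simp: eventually_sequentially)
  obtain m s where m: "m > 0"
    and ms: "(\<integral>p. \<bar>\<psi> n p * indicator half_sq p - step_kernel m s p\<bar> \<partial>lborel) < e / 3"
    using step_approx_continuous [OF \<psi>, of "e / 3" n] \<open>e > 0\<close> by auto
  have i\<psi>: "integrable lborel (\<lambda>p. \<psi> n p * indicator half_sq p)"
    by (rule Bochner_Integration.integrable_bound
          [OF integrable_mult_right [OF integrable_half_sq, of "real k"]])
       (use \<psi> in \<open>auto simp: indicator_def\<close>)
  have "(\<integral>p. \<bar>g p - step_kernel m s p\<bar> \<partial>lborel)
      \<le> (\<integral>p. \<bar>g p - g' p\<bar> + \<bar>g' p - \<psi> n p * indicator half_sq p\<bar>
          + \<bar>\<psi> n p * indicator half_sq p - step_kernel m s p\<bar> \<partial>lborel)"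
    using g g'_int i\<psi> integrable_step_kernel [OF m]
    by (intro integral_mono) auto
  also have "\<dots> = (\<integral>p. \<bar>g p - g' p\<bar> \<partial>lborel) + (\<integral>p. \<bar>g' p - \<psi> n p * indicator half_sq p\<bar> \<partial>lborel)
          + (\<integral>p. \<bar>\<psi> n p * indicator half_sq p - step_kernel m s p\<bar> \<partial>lborel)"
    using g g'_int i\<psi> integrable_step_kernel [OF m] by simp
  also have "\<dots> < e"
    using k n ms by (simp add: g'_def)
  finally show ?thesis using that m by blast
qed

text \<open>Jensen's inequality concerns averages and not arbitrary step kernels. If some
  \<open>s\<close> is within e / 2 of \<open>g\<close>, contraction puts the averages within e / 2
  of \<open>s\<close>.\<close>

lemma cell_avg_approx:
  fixes g :: "real \<times> real \<Rightarrow> real"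
  assumes g: "integrable lborel g" and off: "\<And>p. p \<notin> half_sq \<Longrightarrow> g p = 0" and "e > 0"
  obtains m where "m > 0" "(\<integral>p. \<bar>g p - step_kernel m (cell_avg m g) p\<bar> \<partial>lborel) < e"
proof -
  obtain m s where m: "m > 0" and s: "(\<integral>p. \<bar>g p - step_kernel m s p\<bar> \<partial>lborel) < e / 2"
    using step_approx_integrable [OF g off, of "e / 2"] \<open>e > 0\<close> by auto
  note int = g integrable_step_kernel [OF m]
  have "(\<integral>p. \<bar>g p - step_kernel m (cell_avg m g) p\<bar> \<partial>lborel)
      \<le> (\<integral>p. \<bar>g p - step_kernel m s p\<bar> + \<bar>step_kernel m s p - step_kernel m (cell_avg m g) p\<bar> \<partial>lborel)"
    using int by (intro integral_mono) auto
  also have "\<dots> = (\<integral>p. \<bar>g p - step_kernel m s p\<bar> \<partial>lborel)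
      + (\<integral>p. \<bar>step_kernel m s p - step_kernel m (cell_avg m g) p\<bar> \<partial>lborel)"
    using int by simp
  also have "\<dots> < e"
    using s cell_avg_contraction [OF g m, of s] by linarith
  finally show ?thesis using that m by blast
qed

subsection \<open>Borel versions and cell averages\<close>

text \<open>All grid lines have rational coordinates. Discarding such points once removes the
  difference between closed blocks and half-open cells for every n simultaneously.\<close>

lemma AE_lborel_irrational: "AE p in lborel. fst (p :: real \<times> real) \<notin> \<rat> \<and> snd p \<notin> \<rat>"
proof -
  have Q: "\<rat> \<in> null_sets (lborel :: real measure)"
    using countable_rat by (rule countable_imp_null_set_lborel)
  then have Qb: "(\<rat> :: real set) \<in> sets borel" by auto
  have 1: "\<rat> \<times> UNIV \<in> null_sets ((lborel :: real measure) \<Otimes>\<^sub>M (lborel :: real measure))"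
    using Q Qb by (intro null_setsI pair_measureI) (simp_all add: lborel.emeasure_pair_measure_Times null_setsD1)
  have 2: "UNIV \<times> \<rat> \<in> null_sets ((lborel :: real measure) \<Otimes>\<^sub>M (lborel :: real measure))"
    using Q Qb by (intro null_setsI pair_measureI) (simp_all add: lborel.emeasure_pair_measure_Times null_setsD1)
  from AE_not_in [OF 1] AE_not_in [OF 2] show ?thesis
    unfolding lborel_prod by eventually_elim (auto simp: mem_Times_iff)
qed

lemma le_enn2realI: "ennreal a \<le> X \<Longrightarrow> X < \<infinity> \<Longrightarrow> a \<le> enn2real X"
  by (cases X) auto

lemma matrix_kernel_irrational:
  assumes n: "n > 0" and p: "fst p \<notin> \<rat>" "snd p \<notin> \<rat>"
  shows "indicator unit_sq p * matrix_kernel n x p = step_kernel n (sym_entry x) p"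
    and "indicator unit_sq p = (indicator half_sq p :: real)"
proof -
  obtain s t where st: "p = (s, t)" by (cases p)
  have ne: "s \<noteq> q" "t \<noteq> q" if "q \<in> \<rat>" for q
    using p that st by auto
  have "s \<noteq> 1" "t \<noteq> 1" using ne by auto
  then show eq: "indicator unit_sq p = (indicator half_sq p :: real)"
    by (auto simp: st unit_sq_def half_sq_def indicator_def)
  show "indicator unit_sq p * matrix_kernel n x p = step_kernel n (sym_entry x) p"
  proof (cases "p \<in> half_sq")
    case True
    then have 0: "0 \<le> s" "s < 1" "0 \<le> t" "t < 1" by (auto simp: st half_sq_def)
    have rat: "(real i + 1) / real n \<in> \<rat>" for i
      by (intro Rats_divide Rats_add Rats_of_nat Rats_1)
    have ind_s: "indicator (block_int n i) s = (if i = grid_idx n s then 1 else 0 :: real)" for i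
    proof -
      have "s \<in> block_int n i \<longleftrightarrow> grid_idx n s = i"
        unfolding grid_idx_eq_iff [OF 0(1) n] block_int_def
        using ne(1) [OF rat, of i] by (metis atLeastAtMost_iff order_le_less)
      then show ?thesis by (auto simp: indicator_def)
    qed
    have ind_t: "indicator (block_int n i) t = (if i = grid_idx n t then 1 else 0 :: real)" for i
    proof -
      have "t \<in> block_int n i \<longleftrightarrow> grid_idx n t = i"
        unfolding grid_idx_eq_iff [OF 0(3) n] block_int_def
        using ne(2) [OF rat, of i] by (metis atLeastAtMost_iff order_le_less)
      then show ?thesis by (auto simp: indicator_def)
    qed
    have "matrix_kernel n x p = (\<Sum>i<n. \<Sum>j<n. if i = grid_idx n s then if j = grid_idx n t then sym_entry x i j else 0 else 0)"
      unfolding matrix_kernel_def st prod.case ind_s ind_t by (intro sum.cong refl) simp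
    also have "\<dots> = (\<Sum>i<n. if i = grid_idx n s then sym_entry x i (grid_idx n t) else 0)"
      using grid_idx_less [OF 0(3,4) n] by (intro sum.cong refl) (auto simp: sum.delta')
    also have "\<dots> = sym_entry x (grid_idx n s) (grid_idx n t)"
      using grid_idx_less [OF 0(1,2) n] by (simp add: sum.delta')
    finally show ?thesis
      using True unfolding eq by (simp add: step_kernel_def st)
  qed (simp add: eq step_kernel_def)
qed

text \<open>The bound |f| \<le> 1 + f^2 suffices, as the square has finite measure.\<close>

lemma kernel_space_integrable:
  assumes "f \<in> kernel_space"
  shows "set_integrable lebesgue unit_sq f"
proof -
  have U: "unit_sq \<in> sets lebesgue" "emeasure lebesgue unit_sq < \<infinity>"
    using measure_lborel_Times [of "{0..1}" "{0..1}"] by (auto simp: unit_sq_def)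
  have m: "(\<lambda>p. indicator unit_sq p * f p) \<in> borel_measurable lebesgue"
    using assms U by (simp add: kernel_space_def borel_measurable_restrict_space_iff)
  have i: "integrable lebesgue (\<lambda>p. indicator unit_sq p + indicator unit_sq p * (f p)\<^sup>2)"
    using assms U by (auto simp: kernel_space_def set_integrable_def intro!: integrable_real_indicator)
  show ?thesis
    unfolding set_integrable_def real_scaleR_def
  proof (rule Bochner_Integration.integrable_bound [OF i m], intro AE_I2)
    fix p
    have "\<bar>f p\<bar> \<le> 1 + (f p)\<^sup>2"
      using zero_le_power2 [of "\<bar>f p\<bar> - 1"] abs_ge_zero [of "f p"]
      unfolding power2_diff by simp
    then show "norm (indicator unit_sq p * f p) \<le> norm (indicator unit_sq p + indicator unit_sq p * (f p)\<^sup>2)"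
      by (simp add: indicator_def)
  qed
qed

text \<open>A Borel version of f need not be symmetric, so it is averaged with its transpose.
  Agreement with f almost everywhere persists because exchanging the coordinates preserves Lebesgue
  measure and f is symmetric.\<close>

lemma ex_borel_version:
  assumes f: "f \<in> kernel_space"
  obtains g where "integrable lborel g" "\<And>p. p \<notin> half_sq \<Longrightarrow> g p = 0" "\<And>x y. g (x, y) = g (y, x)"
    "AE p in lborel. p \<in> unit_sq \<longrightarrow> f p = g p"
proof -
  have int: "integrable lebesgue (\<lambda>p. indicator unit_sq p * f p)"
    using kernel_space_integrable [OF f] by (simp add: set_integrable_def)
  then obtain g0 where [measurable]: "g0 \<in> borel_measurable lborel"
    and g0: "AE p in lborel. indicator unit_sq p * f p = g0 p"
    using completion_ex_borel_measurable_real by blast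
  have "integrable lebesgue g0"
    by (rule integrable_cong_AE_imp [OF int])
       (use g0 in \<open>auto intro!: AE_completion measurable_completion elim: eventually_mono\<close>)
  then have g0i: "integrable lborel g0"
    by (simp add: integrable_completion)
  have swap: "lborel = distr lborel lborel (\<lambda>(x :: real, y :: real). (y, x))"
    using lborel_pair.distr_pair_swap unfolding lborel_prod by simp
  have g0': "AE p in lborel. (case p of (x, y) \<Rightarrow> indicator unit_sq (y, x) * f (y, x) = g0 (y, x))"
  proof -
    have m: "(\<lambda>(x, y). (y, x)) \<in> measurable lborel (lborel :: (real \<times> real) measure)"
      using measurable_pair_swap' [of lborel lborel] unfolding lborel_prod .
    have "AE p in distr lborel lborel (\<lambda>(x, y). (y, x)). indicator unit_sq p * f p = g0 p"
      by (subst swap [symmetric]) (rule g0)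
    from AE_distrD [OF m this] show ?thesis
      by eventually_elim auto
  qed
  define g where "g p = (g0 p + g0 (snd p, fst p)) / 2 * indicator half_sq p" for p
  have "integrable (lborel \<Otimes>\<^sub>M lborel) (\<lambda>(x, y). g0 (y, x))"
    using g0i by (intro lborel_pair.integrable_product_swap) (simp add: lborel_prod)
  then have "integrable lborel (\<lambda>p. g0 (snd p, fst p))"
    unfolding lborel_prod by (simp add: split_beta')
  then have "integrable lborel (\<lambda>p. indicator half_sq p *\<^sub>R ((g0 p + g0 (snd p, fst p)) / 2))"
    using g0i by (intro integrable_mult_indicator) auto
  then have 1: "integrable lborel g"
    by (simp add: g_def [abs_def] mult.commute)
  have 2: "g p = 0" if "p \<notin> half_sq" for p
    using that by (simp add: g_def)
  have 3: "g (x, y) = g (y, x)" for x y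
    by (auto simp: g_def half_sq_def indicator_def)
  have 4: "AE p in lborel. p \<in> unit_sq \<longrightarrow> f p = g p"
    using g0 g0' AE_lborel_irrational
  proof eventually_elim
    case (elim p)
    obtain x y where p: "p = (x, y)" by (cases p)
    show ?case
    proof
      assume u: "p \<in> unit_sq"
      then have u': "(y, x) \<in> unit_sq" and "f (y, x) = f (x, y)"
        using f by (auto simp: p unit_sq_def kernel_space_def)
      moreover have "p \<in> half_sq"
        using u elim(3) matrix_kernel_irrational(2) [of 1 p] by (auto simp: indicator_def split: if_splits)
      ultimately show "f p = g p"
        using elim u by (simp add: g_def p)
    qed
  qed
  show ?thesis by (rule that [OF 1 2 3 4])
qed

text \<open>The rate is lower semicontinuous: being a supremum of affine functions, it has closed
  sublevel sets.\<close>

lemma cramer_rate_borel [measurable]: "cramer_rate \<mu> \<in> borel_measurable borel"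
proof (rule borel_measurableI_le)
  fix y :: ereal
  have "{x \<in> space borel. cramer_rate \<mu> x \<le> y} = (\<Inter>\<theta>. {x. ereal (\<theta> * x - ln (mgf \<mu> \<theta>)) \<le> y})"
    by (auto simp: cramer_rate_def SUP_le_iff)
  moreover have "closed {x. ereal (\<theta> * x - ln (mgf \<mu> \<theta>)) \<le> y}" for \<theta>
    by (intro closed_Collect_le continuous_on_ereal continuous_on_const) (intro continuous_intros)
  ultimately show "{x \<in> space borel. cramer_rate \<mu> x \<le> y} \<in> sets borel"
    by (simp add: borel_closed closed_INT)
qed

section \<open>Distance and rate in terms of the Borel version\<close>

context
  fixes f g :: "real \<times> real \<Rightarrow> real"
  assumes f: "f \<in> kernel_space" and g: "integrable lborel g"
    and off: "\<And>p. p \<notin> half_sq \<Longrightarrow> g p = 0"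
    and fg: "AE p in lborel. p \<in> unit_sq \<longrightarrow> f p = g p"
begin

lemma g_borel [measurable]: "g \<in> borel_measurable borel"
  using borel_measurable_integrable [OF g] by simp

lemma L1_dist_eq_lborel:
  assumes n: "n > 0"
  shows "(LINT p:unit_sq|lebesgue. \<bar>matrix_kernel n x p - f p\<bar>)
    = (\<integral>p. \<bar>g p - step_kernel n (sym_entry x) p\<bar> \<partial>lborel)"
proof -
  have i: "set_integrable lebesgue unit_sq (\<lambda>p. \<bar>matrix_kernel n x p - f p\<bar>)"
    by (intro set_integrable_abs set_integral_diff set_integrable_matrix_kernel kernel_space_integrable f)
  have "(LINT p:unit_sq|lebesgue. \<bar>matrix_kernel n x p - f p\<bar>)
      = (\<integral>p. \<bar>g p - step_kernel n (sym_entry x) p\<bar> \<partial>lebesgue)"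
    unfolding set_lebesgue_integral_def
  proof (rule integral_cong_AE)
    show "(\<lambda>p. indicator unit_sq p *\<^sub>R \<bar>matrix_kernel n x p - f p\<bar>) \<in> borel_measurable lebesgue"
      using i by (auto simp: set_integrable_def)
    show "(\<lambda>p. \<bar>g p - step_kernel n (sym_entry x) p\<bar>) \<in> borel_measurable lebesgue"
      by (intro measurable_completion) simp
    have "AE p in lborel. indicator unit_sq p *\<^sub>R \<bar>matrix_kernel n x p - f p\<bar> = \<bar>g p - step_kernel n (sym_entry x) p\<bar>"
      using AE_lborel_irrational fg
    proof eventually_elim
      case (elim p)
      then show ?case
        using matrix_kernel_irrational(1) [OF n, of p x] matrix_kernel_irrational(2) [OF n, of p] off [of p]
        by (auto simp: indicator_def step_kernel_def split: if_splits)
    qed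
    then show "AE p in lebesgue. indicator unit_sq p *\<^sub>R \<bar>matrix_kernel n x p - f p\<bar> = \<bar>g p - step_kernel n (sym_entry x) p\<bar>"
      by (rule AE_completion)
  qed
  also have "\<dots> = (\<integral>p. \<bar>g p - step_kernel n (sym_entry x) p\<bar> \<partial>lborel)"
    by (rule integral_completion) simp
  finally show ?thesis .
qed

lemma rate_I_eq_lborel:
  "rate_I \<mu> f = (\<integral>\<^sup>+p. e2ennreal (cramer_rate \<mu> (g p)) * indicator half_sq p \<partial>lborel) / 2"
proof -
  have "(\<integral>\<^sup>+p\<in>unit_sq. e2ennreal (cramer_rate \<mu> (f p)) \<partial>lebesgue)
      = (\<integral>\<^sup>+p. e2ennreal (cramer_rate \<mu> (g p)) * indicator half_sq p \<partial>lebesgue)"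
  proof (rule nn_integral_cong_AE, rule AE_completion)
    show "AE p in lborel. e2ennreal (cramer_rate \<mu> (f p)) * indicator unit_sq p
        = e2ennreal (cramer_rate \<mu> (g p)) * indicator half_sq p"
      using AE_lborel_irrational fg
    proof eventually_elim
      case (elim p)
      then show ?case
        using matrix_kernel_irrational(2) [of 1 p] by (auto simp: indicator_def split: if_splits)
    qed
  qed
  then show ?thesis
    unfolding rate_I_def by (simp add: nn_integral_completion)
qed

text \<open>Jensen's inequality for the convex function \<^const>\<open>cramer_rate\<close>, which is a supremum of
  affine functions.\<close>

lemma cell_avg_affine_le:
  assumes fin: "(\<integral>\<^sup>+p. e2ennreal (cramer_rate \<mu> (g p)) * indicator (grid_cell m i j) p \<partial>lborel) < \<infinity>"
    and m: "m > 0"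
  shows "t * cell_avg m g i j - ln (mgf \<mu> t)
    \<le> (real m)\<^sup>2 * enn2real (\<integral>\<^sup>+p. e2ennreal (cramer_rate \<mu> (g p)) * indicator (grid_cell m i j) p \<partial>lborel)"
proof -
  let ?I = "indicator (grid_cell m i j) :: _ \<Rightarrow> real"
  let ?F = "\<lambda>p. (t * g p - ln (mgf \<mu> t)) * ?I p"
  have gI: "integrable lborel (\<lambda>p. g p * ?I p)"
    using integrable_mult_indicator [OF _ g, of "grid_cell m i j"] by (simp add: mult.commute)
  have F_eq: "?F p = t * (g p * ?I p) - ln (mgf \<mu> t) * ?I p" for p
    by (simp add: algebra_simps)
  have F: "integrable lborel ?F"
    unfolding F_eq using gI integrable_grid_cell [OF m] by auto
  have F1: "(\<integral>p. ?F p \<partial>lborel) = (t * cell_avg m g i j - ln (mgf \<mu> t)) / (real m)\<^sup>2"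
    unfolding F_eq using gI integrable_grid_cell [OF m, of i j] m emeasure_grid_cell(2) [OF m, of i j]
    by (simp add: cell_avg_def diff_divide_distrib)
  \<comment> \<open>The affine minorant may be negative while \<open>ennreal\<close> is not. Passing
    to the positive part matches \<open>e2ennreal\<close>, which sends negative numbers to
    0.\<close>
  have F2: "(\<integral>p. ?F p \<partial>lborel) \<le> (\<integral>p. max 0 (?F p) \<partial>lborel)"
    using F by (intro integral_mono) auto
  have F3: "ennreal (\<integral>p. max 0 (?F p) \<partial>lborel) = (\<integral>\<^sup>+p. ennreal (max 0 (?F p)) \<partial>lborel)"
    using F by (intro nn_integral_eq_integral [symmetric]) auto
  have F4: "(\<integral>\<^sup>+p. ennreal (max 0 (?F p)) \<partial>lborel)
      \<le> (\<integral>\<^sup>+p. e2ennreal (cramer_rate \<mu> (g p)) * indicator (grid_cell m i j) p \<partial>lborel)"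
  proof (rule nn_integral_mono)
    fix p
    have "ereal (t * g p - ln (mgf \<mu> t)) \<le> cramer_rate \<mu> (g p)"
      unfolding cramer_rate_def by (rule SUP_upper) simp
    then have "e2ennreal (ereal (t * g p - ln (mgf \<mu> t))) \<le> e2ennreal (cramer_rate \<mu> (g p))"
      by (rule e2ennreal_mono)
    then show "ennreal (max 0 (?F p)) \<le> e2ennreal (cramer_rate \<mu> (g p)) * indicator (grid_cell m i j) p"
      by (simp add: indicator_def e2ennreal_ereal)
  qed
  have "ennreal ((t * cell_avg m g i j - ln (mgf \<mu> t)) / (real m)\<^sup>2)
      \<le> (\<integral>\<^sup>+p. e2ennreal (cramer_rate \<mu> (g p)) * indicator (grid_cell m i j) p \<partial>lborel)"
    using order_trans [OF ennreal_leI [OF F2] order_trans [OF eq_refl [OF F3] F4]] unfolding F1 .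
  then have "(t * cell_avg m g i j - ln (mgf \<mu> t)) / (real m)\<^sup>2
      \<le> enn2real (\<integral>\<^sup>+p. e2ennreal (cramer_rate \<mu> (g p)) * indicator (grid_cell m i j) p \<partial>lborel)"
    using fin by (rule le_enn2realI)
  then show ?thesis
    using m by (simp add: field_simps)
qed

text \<open>The cells partition the square, so the cell integrals add up to the full integral of the
  rate, which is twice \<open>rate_I\<close>. Finiteness of every summand lets the identity pass to
  the reals.\<close>

lemma sum_cell_rates:
  assumes fin: "rate_I \<mu> f < \<infinity>" and m: "m > 0"
  defines "C \<equiv> \<lambda>i j. \<integral>\<^sup>+p. e2ennreal (cramer_rate \<mu> (g p)) * indicator (grid_cell m i j) p \<partial>lborel"
  shows "\<And>i j. i < m \<Longrightarrow> j < m \<Longrightarrow> C i j < \<infinity>"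
    and "(\<Sum>i<m. \<Sum>j<m. enn2real (C i j)) = 2 * enn2real (rate_I \<mu> f)"
proof -
  have "(\<Sum>i<m. \<Sum>j<m. C i j)
      = (\<integral>\<^sup>+p. (\<Sum>i<m. \<Sum>j<m. e2ennreal (cramer_rate \<mu> (g p)) * indicator (grid_cell m i j) p) \<partial>lborel)"
    unfolding C_def by (subst nn_integral_sum, simp, intro sum.cong refl nn_integral_sum [symmetric]) simp
  also have "\<dots> = (\<integral>\<^sup>+p. e2ennreal (cramer_rate \<mu> (g p)) * indicator half_sq p \<partial>lborel)"
    by (simp only: sum_grid_cells [OF m])
  also have "\<dots> = 2 * rate_I \<mu> f"
    unfolding rate_I_eq_lborel ennreal_times_divide
    by (subst mult.commute, rule mult_divide_eq_ennreal [symmetric]) simp_all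
  finally have sum: "(\<Sum>i<m. \<Sum>j<m. C i j) = 2 * rate_I \<mu> f" .
  then have lt: "(\<Sum>i<m. \<Sum>j<m. C i j) < \<infinity>"
    using fin by (simp add: ennreal_mult_less_top)
  show C: "C i j < \<infinity>" if "i < m" "j < m" for i j
    using lt that by (auto simp: less_top)
  have "(\<Sum>i<m. \<Sum>j<m. enn2real (C i j)) = enn2real (\<Sum>i<m. \<Sum>j<m. C i j)"
  proof -
    have "(\<Sum>i<m. \<Sum>j<m. enn2real (C i j)) = (\<Sum>i<m. enn2real (\<Sum>j<m. C i j))"
      using C by (intro sum.cong refl, subst enn2real_sum) auto
    also have "\<dots> = enn2real (\<Sum>i<m. \<Sum>j<m. C i j)"
      using lt by (subst enn2real_sum) (auto simp: less_top)
    finally show ?thesis .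
  qed
  then show "(\<Sum>i<m. \<Sum>j<m. enn2real (C i j)) = 2 * enn2real (rate_I \<mu> f)"
    unfolding sum by (simp add: enn2real_mult)
qed

end

subsection \<open>Refining the grid\<close>

text \<open>For n > 0 the quotient is the k with k / m < (i + 1) / n \<le> (k + 1) / m; subtracting
  1 before the division makes the coarse cell closed on the right. The minimum keeps the index below
  m also for i \<ge> n.\<close>

definition refine_idx :: "nat \<Rightarrow> nat \<Rightarrow> nat \<Rightarrow> nat" where
  "refine_idx m n i = min (m - 1) (((i + 1) * m - 1) div n)"

lemma refine_idx_less: "m > 0 \<Longrightarrow> refine_idx m n i < m"
  by (simp add: refine_idx_def)

text \<open>The right end point of a cell of the fine grid determines the cell of the coarse grid: with
  the left end point the two indices would disagree infinitely often when \<open>m * s\<close> is an integer.\<close>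

lemma eventually_refine_idx:
  assumes s: "0 \<le> s" "s < 1" and m: "m > 0"
  shows "\<forall>\<^sub>F n in sequentially. refine_idx m n (grid_idx n s) = grid_idx m s"
proof -
  define k where "k = grid_idx m s"
  have k: "real k \<le> real m * s" "real m * s < real k + 1"
    using grid_idx_eq_iff [OF s(1) m, of k] m by (auto simp: k_def field_simps)
  have km: "k < m"
    unfolding k_def by (rule grid_idx_less [OF s m])
  \<comment> \<open>d / m is the distance from s to the right end of its coarse cell. Once n > m /
    d, the fine cell containing s ends before that point.\<close>
  define d where "d = real k + 1 - real m * s"
  have d: "d > 0" using k by (simp add: d_def)
  have "\<forall>\<^sub>F n in sequentially. real n > real m / d"
    using filterlim_at_top_dense filterlim_real_sequentially by blast
  then show ?thesis
    using eventually_gt_at_top [of 0]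
  proof eventually_elim
    case (elim n)
    define i where "i = grid_idx n s"
    have i: "real i \<le> real n * s" "real n * s < real i + 1"
      using grid_idx_eq_iff [OF s(1) elim(2), of i] elim(2) by (auto simp: i_def field_simps)
    have "real (n * k) \<le> real n * (real m * s)"
      using k(1) by (simp add: mult_left_mono)
    also have "\<dots> = real m * (real n * s)" by simp
    also have "\<dots> < real m * (real i + 1)"
      using i(2) m by simp
    also have "\<dots> = real ((i + 1) * m)" by (simp add: algebra_simps)
    finally have 1: "n * k \<le> (i + 1) * m - 1"
      unfolding of_nat_less_iff by linarith
    have "real ((i + 1) * m) = real m * real i + real m" by (simp add: algebra_simps)
    also have "\<dots> \<le> real m * (real n * s) + real m"
      using i(1) by (simp add: mult_left_mono)
    also have "\<dots> < real m * (real n * s) + real n * d"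
      using elim d by (simp add: field_simps)
    also have "\<dots> = real (n * Suc k)"
      by (simp add: d_def algebra_simps)
    finally have 2: "(i + 1) * m - 1 < n * Suc k"
      unfolding of_nat_less_iff by linarith
    have "((i + 1) * m - 1) div n = k"
      by (rule div_nat_eqI [OF 1 2])
    then show ?case
      using km unfolding refine_idx_def i_def [symmetric] k_def [symmetric] by simp
  qed
qed

lemma member_le_double_sum:
  fixes a :: "nat \<Rightarrow> nat \<Rightarrow> real"
  assumes "i < m" "j < m"
  shows "\<bar>a i j\<bar> \<le> (\<Sum>i<m. \<Sum>j<m. \<bar>a i j\<bar>)"
proof -
  have "\<bar>a i j\<bar> \<le> (\<Sum>j<m. \<bar>a i j\<bar>)"
    using assms by (intro member_le_sum) auto
  also have "\<dots> \<le> (\<Sum>i<m. \<Sum>j<m. \<bar>a i j\<bar>)"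
    using assms by (intro member_le_sum [of i _ "\<lambda>i. \<Sum>j<m. \<bar>a i j\<bar>"]) (auto intro: sum_nonneg)
  finally show ?thesis .
qed

text \<open>At each fixed point the two kernels agree for all large n, and both take only the
  finitely many values of \<open>a\<close>, or 0. It is applied both to the tilted means, for the
  distance to f, and to the entropies, for the cost.\<close>

lemma step_kernel_refine_tendsto:
  fixes a :: "nat \<Rightarrow> nat \<Rightarrow> real"
  assumes m: "m > 0"
  defines "b \<equiv> \<lambda>n i j. a (refine_idx m n i) (refine_idx m n j)"
  shows "(\<lambda>n. \<integral>p. \<bar>step_kernel m a p - step_kernel n (b n) p\<bar> \<partial>lborel) \<longlonglongrightarrow> 0"
proof -
  define A where "A = (\<Sum>i<m. \<Sum>j<m. \<bar>a i j\<bar>)"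
  have A: "\<bar>a i j\<bar> \<le> A" if "i < m" "j < m" for i j
    unfolding A_def by (rule member_le_double_sum [OF that])
  have "(\<lambda>n. \<integral>p. \<bar>step_kernel m a p - step_kernel n (b n) p\<bar> \<partial>lborel)
      \<longlonglongrightarrow> (\<integral>p. (0 :: real) \<partial>(lborel :: (real \<times> real) measure))"
  proof (rule integral_dominated_convergence [where w = "\<lambda>p. 2 * A * indicator half_sq p"])
    show "integrable lborel (\<lambda>p. 2 * A * indicator half_sq p)"
      using integrable_half_sq by simp
    show "AE p in lborel. (\<lambda>n. \<bar>step_kernel m a p - step_kernel n (b n) p\<bar>) \<longlonglongrightarrow> 0"
    proof (intro AE_I2 tendsto_eventually)
      fix p :: "real \<times> real"
      show "\<forall>\<^sub>F n in sequentially. \<bar>step_kernel m a p - step_kernel n (b n) p\<bar> = 0"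
      proof (cases "p \<in> half_sq")
        case True
        then have "\<forall>\<^sub>F n in sequentially. refine_idx m n (grid_idx n (fst p)) = grid_idx m (fst p)"
          "\<forall>\<^sub>F n in sequentially. refine_idx m n (grid_idx n (snd p)) = grid_idx m (snd p)"
          using eventually_refine_idx m by (auto simp: half_sq_def)
        then show ?thesis
          by eventually_elim (simp add: step_kernel_def b_def)
      qed (simp add: step_kernel_def)
    qed
    show "AE p in lborel. norm \<bar>step_kernel m a p - step_kernel n (b n) p\<bar> \<le> 2 * A * indicator half_sq p" for n
    proof (intro AE_I2)
      fix p
      show "norm \<bar>step_kernel m a p - step_kernel n (b n) p\<bar> \<le> 2 * A * indicator half_sq p"
      proof (cases "p \<in> half_sq")
        case True
        then have "\<bar>a (grid_idx m (fst p)) (grid_idx m (snd p))\<bar> \<le> A"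
          by (intro A grid_idx_less m) (auto simp: half_sq_def)
        moreover have "\<bar>b n (grid_idx n (fst p)) (grid_idx n (snd p))\<bar> \<le> A"
          unfolding b_def by (intro A refine_idx_less m)
        ultimately show ?thesis using True by (simp add: step_kernel_def)
      qed (simp add: step_kernel_def)
    qed
  qed auto
  then show ?thesis by simp
qed

section \<open>Sums over the upper triangle\<close>

lemma finite_upper_idx [simp]: "finite (upper_idx n)"
  by (rule finite_subset [of _ "{..<n} \<times> {..<n}"]) (auto simp: upper_idx_def)

lemma card_upper_idx_le: "real (card (upper_idx n)) \<le> (real n)\<^sup>2"
proof -
  have "card (upper_idx n) \<le> card ({..<n} \<times> {..<n})"
    by (intro card_mono) (auto simp: upper_idx_def)
  also have "\<dots> = n\<^sup>2" by (simp add: power2_eq_square)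
  finally have "real (card (upper_idx n)) \<le> real (n\<^sup>2)" by simp
  then show ?thesis by simp
qed

text \<open>Reflection exchanges the two strict triangles. The full square counts each off-diagonal
  pair twice but the diagonal once, hence the correction term.\<close>

lemma sum_upper_idx:
  fixes u :: "nat \<Rightarrow> nat \<Rightarrow> real"
  assumes sym: "\<And>i j. u i j = u j i"
  shows "2 * (\<Sum>(i, j)\<in>upper_idx n. u i j) = (\<Sum>i<n. \<Sum>j<n. u i j) + (\<Sum>i<n. u i i)"
proof -
  let ?L = "{(i, j). j < i \<and> i < n}" and ?U = "{(i, j). i < j \<and> j < n}" and ?D = "(\<lambda>i. (i, i)) ` {..<n}"
  have fin: "finite ?L" "finite ?U"
    by (rule finite_subset [of _ "{..<n} \<times> {..<n}"]; auto)+
  have "(\<Sum>i<n. \<Sum>j<n. u i j) = (\<Sum>(i, j)\<in>{..<n} \<times> {..<n}. u i j)"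
    by (rule sum.cartesian_product)
  also have "{..<n} \<times> {..<n} = upper_idx n \<union> ?L"
    by (auto simp: upper_idx_def)
  also have "(\<Sum>(i, j)\<in>upper_idx n \<union> ?L. u i j) = (\<Sum>(i, j)\<in>upper_idx n. u i j) + (\<Sum>(i, j)\<in>?L. u i j)"
    by (rule sum.union_disjoint) (use fin finite_upper_idx [of n] in \<open>auto simp: upper_idx_def\<close>)
  also have "(\<Sum>(i, j)\<in>?L. u i j) = (\<Sum>(i, j)\<in>?U. u i j)"
    by (rule sum.reindex_bij_witness [where i = prod.swap and j = prod.swap]) (auto simp: sym)
  finally have 1: "(\<Sum>i<n. \<Sum>j<n. u i j) = (\<Sum>(i, j)\<in>upper_idx n. u i j) + (\<Sum>(i, j)\<in>?U. u i j)" .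
  have "upper_idx n = ?U \<union> ?D"
    by (auto simp: upper_idx_def)
  then have "(\<Sum>(i, j)\<in>upper_idx n. u i j) = (\<Sum>(i, j)\<in>?U. u i j) + (\<Sum>(i, j)\<in>?D. u i j)"
    by (simp only:) (rule sum.union_disjoint, use fin in auto)
  also have "(\<Sum>(i, j)\<in>?D. u i j) = (\<Sum>i<n. u i i)"
    by (subst sum.reindex) (auto simp: inj_on_def)
  finally show ?thesis using 1 by simp
qed

text \<open>The positions (i, j) and (j, i) hold the same random variable. The weight counts how
  often the block meets it, which is 0, 1 or 2, so that a block sum becomes a linear form in
  independent variables.\<close>

definition block_weight :: "nat set \<Rightarrow> nat set \<Rightarrow> nat \<times> nat \<Rightarrow> real" where
  "block_weight A B e = real (card {p \<in> A \<times> B. (min (fst p) (snd p), max (fst p) (snd p)) = e})"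

lemma block_weight_le: "\<bar>block_weight A B e\<bar> \<le> 2"
proof -
  have "card {p \<in> A \<times> B. (min (fst p) (snd p), max (fst p) (snd p)) = e} \<le> card {(fst e, snd e), (snd e, fst e)}"
    by (intro card_mono) (auto simp: min_def max_def split: if_splits)
  also have "\<dots> \<le> 2"
    by (simp add: card_insert_if)
  finally show ?thesis by (simp add: block_weight_def)
qed

lemma sum_sym_entry_block:
  assumes "A \<subseteq> {..<n}" "B \<subseteq> {..<n}"
  shows "(\<Sum>i\<in>A. \<Sum>j\<in>B. sym_entry y i j) = (\<Sum>e\<in>upper_idx n. block_weight A B e * y e)"
proof -
  let ?k = "\<lambda>p. (min (fst p) (snd p), max (fst p) (snd p))"
  have fin: "finite A" "finite B"
    using assms finite_subset by blast+
  have "(\<Sum>i\<in>A. \<Sum>j\<in>B. sym_entry y i j) = (\<Sum>p\<in>A \<times> B. y (?k p))"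
    unfolding sum.cartesian_product by (intro sum.cong refl) (auto simp: sym_entry_def min_def max_def)
  also have "\<dots> = (\<Sum>e\<in>upper_idx n. \<Sum>p\<in>{p \<in> A \<times> B. ?k p = e}. y (?k p))"
    by (rule sum.group [symmetric]) (use fin finite_upper_idx [of n] assms in \<open>auto simp: upper_idx_def\<close>)
  also have "\<dots> = (\<Sum>e\<in>upper_idx n. \<Sum>p\<in>{p \<in> A \<times> B. ?k p = e}. y e)"
    by (intro sum.cong refl) auto
  also have "\<dots> = (\<Sum>e\<in>upper_idx n. block_weight A B e * y e)"
    by (simp add: block_weight_def)
  finally show ?thesis .
qed

text \<open>1 + 2 * 4^n counts linear forms: two signs for each of the 4^n pairs of index sets, and
  one for the likelihood ratio. Once ln 4 - \<beta> n \<le> -1, the left side is at most 3 exp (-n),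
  and exp n \<ge> 6 finishes.\<close>

lemma eventually_union_bound:
  assumes "\<beta> > 0"
  shows "\<forall>\<^sub>F n in sequentially. (1 + 2 * 4 ^ n) * exp (- \<beta> * (real n)\<^sup>2) \<le> 1 / 2"
proof -
  have "\<forall>\<^sub>F n in sequentially. real n > (1 + ln 4) / \<beta>"
    using filterlim_at_top_dense filterlim_real_sequentially by blast
  then show ?thesis
    using eventually_ge_at_top [of 6]
  proof eventually_elim
    case (elim n)
    have "(1 + 2 * 4 ^ n) * exp (- \<beta> * (real n)\<^sup>2) \<le> 3 * 4 ^ n * exp (- \<beta> * (real n)\<^sup>2)"
      by (intro mult_right_mono) auto
    also have "\<dots> = 3 * exp (real n * ln 4 - \<beta> * (real n)\<^sup>2)"
      by (simp add: exp_diff exp_minus exp_of_nat_mult field_simps)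
    also have "real n * ln 4 - \<beta> * (real n)\<^sup>2 = real n * (ln 4 - \<beta> * real n)"
      by (simp add: power2_eq_square algebra_simps)
    also have "3 * exp (real n * (ln 4 - \<beta> * real n)) \<le> 3 * exp (real n * (- 1))"
    proof -
      have "ln 4 - \<beta> * real n \<le> - 1"
        using elim assms by (simp add: field_simps)
      then have "real n * (ln 4 - \<beta> * real n) \<le> real n * (- 1)"
        by (rule mult_left_mono) simp
      then show ?thesis by simp
    qed
    also have "\<dots> = 3 / exp (real n)"
      by (simp add: exp_minus field_simps)
    also have "\<dots> \<le> 3 / 6"
    proof (rule divide_left_mono)
      show "6 \<le> exp (real n)"
        by (rule order_trans [OF _ exp_ge_add_one_self]) (use elim in simp)
    qed auto
    finally show ?case by simp
  qed
qed

subsection \<open>Probability of cut balls\<close>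

context gauss_tail
begin

text \<open>The assumption \<open>L1\<close> controls the distance of the tilted means from f, and
  \<open>cost\<close> the relative entropy of the tilted law. Cut norm and log likelihood may each
  fluctuate by e n^2: the former is the e in \<open>L1\<close>, the latter the e in the exponent.
  The factor 1/2 is the probability left by the union bound.\<close>

lemma Qn_ball_ge:
  fixes \<theta> l K z :: "nat \<Rightarrow> nat \<Rightarrow> real"
  assumes f: "set_integrable lebesgue unit_sq f" and m: "m > 0" and e: "e > 0"
    and norm: "\<And>i j. i < m \<Longrightarrow> j < m \<Longrightarrow>
      (\<integral>x. indicator {- K i j..K i j} x * exp (\<theta> i j * x - l i j) \<partial>\<mu>) = 1"
    and mean: "\<And>i j. i < m \<Longrightarrow> j < m \<Longrightarrow>
      (\<integral>x. x * (indicator {- K i j..K i j} x * exp (\<theta> i j * x - l i j)) \<partial>\<mu>) = z i j"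
    and L1: "\<forall>\<^sub>F n in sequentially. e + (LINT p:unit_sq|lebesgue.
      \<bar>matrix_kernel n (\<lambda>(i, j). z (refine_idx m n i) (refine_idx m n j)) p - f p\<bar>) < \<delta>"
    and cost: "\<forall>\<^sub>F n in sequentially. (\<Sum>(i, j)\<in>upper_idx n.
      \<theta> (refine_idx m n i) (refine_idx m n j) * z (refine_idx m n i) (refine_idx m n j)
        - l (refine_idx m n i) (refine_idx m n j)) \<le> c * (real n)\<^sup>2"
  shows "\<forall>\<^sub>F n in sequentially. exp (- (c + e) * (real n)\<^sup>2) / 2 \<le> Qn_ball \<mu> n f \<delta>"
proof -
  \<comment> \<open>Bounds uniform over all coarse cells. The 1 makes \<open>Km\<close> positive,
    and the 2 in \<open>W\<close> covers the block weights, so that \<open>W\<close> bounds them and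
    the tilts together.\<close>
  define Km where "Km = 1 + (\<Sum>i<m. \<Sum>j<m. \<bar>K i j\<bar>)"
  define W where "W = 2 + (\<Sum>i<m. \<Sum>j<m. \<bar>\<theta> i j\<bar>)"
  have Km: "Km > 0" "\<And>i j. i < m \<Longrightarrow> j < m \<Longrightarrow> K i j \<le> Km"
    using member_le_double_sum [of _ m _ K] unfolding Km_def
    by (auto intro!: add_pos_nonneg sum_nonneg) (smt (verit))
  have W: "W \<ge> 2" "\<And>i j. i < m \<Longrightarrow> j < m \<Longrightarrow> \<bar>\<theta> i j\<bar> \<le> W"
    using member_le_double_sum [of _ m _ \<theta>] unfolding W_def
    by (auto intro!: sum_nonneg) (smt (verit))
  \<comment> \<open>Hoeffding's bound with t = e n^2 and N = n^2 has the exponent (e n^2)^2 / (2 n^2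
    (W Km)^2) = \<beta> n^2.\<close>
  define \<beta> where "\<beta> = e\<^sup>2 / (2 * (W * Km)\<^sup>2)"
  have \<beta>: "\<beta> > 0" using e Km W by (simp add: \<beta>_def)
  show ?thesis
    using eventually_union_bound [OF \<beta>] L1 cost eventually_gt_at_top [of 0]
  proof eventually_elim
    case (elim n)
    define r where "r = refine_idx m n"
    have r: "r i < m" for i unfolding r_def by (rule refine_idx_less [OF m])
    define I where "I = upper_idx n"
    define T where "T = (\<lambda>e. \<theta> (r (fst e)) (r (snd e)))"
    define l' where "l' = (\<lambda>e. l (r (fst e)) (r (snd e)))"
    define K' where "K' = (\<lambda>e. K (r (fst e)) (r (snd e)))"
    define z' where "z' = (\<lambda>e. z (r (fst e)) (r (snd e)))"
    define \<nu> where "\<nu> = (\<lambda>e. density \<mu> (\<lambda>x. ennreal (indicator {-K' e..K' e} x * exp (T e * x - l' e))))"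
    have n1: "(\<integral>x. indicator {-K' e..K' e} x * exp (T e * x - l' e) \<partial>\<mu>) = 1" for e
      unfolding K'_def T_def l'_def by (rule norm [OF r r])
    note tilt = integral_density_tilt [OF sets_mu, of "\<nu> e" "K' e" "T e" "l' e" for e, OF _ n1]
    have prob: "prob_space (\<nu> e)" for e
      by (rule tilt(1)) (simp add: \<nu>_def)
    have bnd: "AE x in \<nu> e. \<bar>x\<bar> \<le> Km" for e
    proof -
      have "AE x in \<nu> e. \<bar>x\<bar> \<le> K' e"
        by (rule tilt(2)) (simp add: \<nu>_def)
      moreover have "K' e \<le> Km" unfolding K'_def by (rule Km(2) [OF r r])
      ultimately show ?thesis by (auto elim: eventually_mono)
    qed
    have mean': "(\<integral>x. x \<partial>\<nu> e) = z' e" for e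
    proof -
      have "(\<integral>x. x \<partial>\<nu> e) = (\<integral>x. x * (indicator {-K' e..K' e} x * exp (T e * x - l' e)) \<partial>\<mu>)"
        by (rule tilt(3)) (simp add: \<nu>_def)
      also have "\<dots> = z' e"
        unfolding K'_def T_def l'_def z'_def by (rule mean [OF r r])
      finally show ?thesis .
    qed
    have sets_nu: "sets (\<nu> e) = sets borel" for e
      by (simp add: \<nu>_def sets_mu)
    interpret P: prob_space "PiM I \<nu>"
      by (rule prob_space_PiM) (rule prob)
    interpret Q: prob_space "PiM I (\<lambda>_. \<mu>)"
      by (rule prob_space_PiM) (rule prob_space_axioms)
    have sets_PiM: "sets (PiM I \<nu>) = sets (PiM I (\<lambda>_. \<mu>))"
      by (rule sets_PiM_cong) (auto simp: \<nu>_def)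
    define G where "G = Pow {..<n} \<times> Pow {..<n}"
    \<comment> \<open>Including the tilts \<open>T\<close> themselves puts the centred log
      likelihood ratio among the linear forms; the two signs of the block weights produce the
      absolute value in the cut norm.\<close>
    define \<W> where "\<W> = insert T ((\<lambda>(A, B). block_weight A B) ` G \<union> (\<lambda>(A, B) e. - block_weight A B e) ` G)"
    have fin_G: "finite G" and card_G: "card G = 4 ^ n"
      by (auto simp: G_def card_cartesian_product card_Pow power_mult_distrib [symmetric])
    have fin_W: "finite \<W>" using fin_G by (simp add: \<W>_def)
    have "card \<W> \<le> 1 + (card G + card G)"
      unfolding \<W>_def using fin_G
      by (intro order_trans [OF card_insert_le_m1] order_trans [OF card_Un_le] add_mono card_image_le)
         (auto intro: order_trans [OF card_Un_le] add_mono card_image_le)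
    then have "real (card \<W>) \<le> real (1 + 2 * 4 ^ n)"
      unfolding card_G by (simp only: of_nat_le_iff)
    then have card_W: "real (card \<W>) \<le> 1 + 2 * 4 ^ n" by simp
    have wW: "\<bar>w e\<bar> \<le> W" if "w \<in> \<W>" for w e
      using that order_trans [OF block_weight_le W(1)] W(2) [OF r r]
      by (cases e) (auto simp: \<W>_def T_def)
    define bad where "bad w = {x \<in> space (PiM I \<nu>). (\<Sum>i\<in>I. w i * (x i - z' i)) \<ge> e * (real n)\<^sup>2}" for w
    have bad_meas: "bad w \<in> sets (PiM I \<nu>)" for w
    proof -
      have "(\<lambda>x. x i) \<in> borel_measurable (PiM I \<nu>)" if "i \<in> I" for i
        using measurable_component_singleton [OF that, of \<nu>] measurable_cong_sets [OF refl sets_nu] by blast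
      then show ?thesis unfolding bad_def by measurable
    qed
    have "P.prob (bad w) \<le> exp (- \<beta> * (real n)\<^sup>2)" if "w \<in> \<W>" for w
    proof -
      have "P.prob (bad w) \<le> exp (- (e * (real n)\<^sup>2)\<^sup>2 / (2 * (real n)\<^sup>2 * (W * Km)\<^sup>2))"
        unfolding bad_def mean' [symmetric]
        using wW [OF that] card_upper_idx_le [of n] elim(4) e Km(1) W(1)
        by (intro Hoeffding_PiM_linear prob sets_nu bnd) (auto simp: I_def)
      also have "- (e * (real n)\<^sup>2)\<^sup>2 / (2 * (real n)\<^sup>2 * (W * Km)\<^sup>2) = - \<beta> * (real n)\<^sup>2"
        using elim(4) by (simp add: \<beta>_def power2_eq_square)
      finally show ?thesis .
    qed
    then have "(\<Sum>w\<in>\<W>. P.prob (bad w)) \<le> real (card \<W>) * exp (- \<beta> * (real n)\<^sup>2)"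
      by (rule sum_bounded_above)
    also have "\<dots> \<le> (1 + 2 * 4 ^ n) * exp (- \<beta> * (real n)\<^sup>2)"
      by (rule mult_right_mono [OF card_W]) simp
    also have "\<dots> \<le> 1 / 2" by (rule elim(1))
    finally have "P.prob (\<Union>w\<in>\<W>. bad w) \<le> 1 / 2"
      using order_trans [OF P.finite_measure_subadditive_finite [OF fin_W, of bad]] bad_meas by blast
    moreover define S where "S = space (PiM I \<nu>) - (\<Union>w\<in>\<W>. bad w)"
    moreover have U: "(\<Union>w\<in>\<W>. bad w) \<in> sets (PiM I \<nu>)"
      using fin_W bad_meas by auto
    ultimately have half: "1 / 2 \<le> P.prob S"
      using P.prob_compl [OF U] by simp
    have S_sets: "S \<in> sets (PiM I (\<lambda>_. \<mu>))"
      unfolding sets_PiM [symmetric] S_def using U by auto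
    have S: "(\<Sum>i\<in>I. w i * (x i - z' i)) < e * (real n)\<^sup>2" if "x \<in> S" "w \<in> \<W>" for x w
      using that by (auto simp: S_def bad_def not_le)
    have "P.prob S \<le> exp ((c + e) * (real n)\<^sup>2) * Q.prob S"
      unfolding \<nu>_def
    proof (rule measure_PiM_tilt_le)
      fix x assume x: "x \<in> S"
      \<comment> \<open>The log likelihood ratio is a centred linear form, small on
        \<open>S\<close>, plus its mean under the tilted law, which is the relative entropy.\<close>
      have "(\<Sum>i\<in>I. T i * x i - l' i) = (\<Sum>i\<in>I. T i * (x i - z' i)) + (\<Sum>i\<in>I. T i * z' i - l' i)"
        by (simp add: sum.distrib [symmetric] algebra_simps)
      also have "(\<Sum>i\<in>I. T i * z' i - l' i) \<le> c * (real n)\<^sup>2"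
        using elim(3) by (simp add: I_def T_def z'_def l'_def r_def case_prod_unfold)
      also have "(\<Sum>i\<in>I. T i * (x i - z' i)) < e * (real n)\<^sup>2"
        by (rule S [OF x]) (simp add: \<W>_def)
      finally show "(\<Sum>i\<in>I. T i * x i - l' i) \<le> (c + e) * (real n)\<^sup>2"
        by (simp add: algebra_simps)
    qed (use prob S_sets sets_mu prob_space_axioms in \<open>auto simp: I_def \<nu>_def\<close>)
    moreover have "Q.prob S \<le> Qn_ball \<mu> n f \<delta>"
      unfolding Qn_ball_def entries_law_def I_def [symmetric]
    proof (rule Q.finite_measure_mono)
      show "S \<subseteq> {x \<in> space (PiM I (\<lambda>_. \<mu>)). cut_dist (matrix_kernel n x) f < \<delta>}"
      proof safe
        fix x assume x: "x \<in> S"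
        then show "x \<in> space (PiM I (\<lambda>_. \<mu>))"
          using S_sets sets.sets_into_space by blast
        have "cut_dist (matrix_kernel n x) f \<le> (e * (real n)\<^sup>2) / (real n)\<^sup>2
            + (LINT p:unit_sq|lebesgue. \<bar>matrix_kernel n z' p - f p\<bar>)"
        proof (rule cut_dist_matrix_kernel_le [OF f elim(4)])
          fix A B assume AB: "A \<subseteq> {..<n}" "B \<subseteq> {..<n}"
          have "(\<Sum>i\<in>I. block_weight A B i * (x i - z' i)) < e * (real n)\<^sup>2"
            using AB by (intro S x) (auto simp: \<W>_def G_def)
          moreover have "(\<Sum>i\<in>I. - block_weight A B i * (x i - z' i)) < e * (real n)\<^sup>2"
            using AB by (intro S x) (auto simp: \<W>_def G_def image_iff)
          ultimately show "\<bar>\<Sum>i\<in>A. \<Sum>j\<in>B. sym_entry (\<lambda>i. x i - z' i) i j\<bar> \<le> e * (real n)\<^sup>2"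
            unfolding sum_sym_entry_block [OF AB] I_def by (simp add: sum_negf)
        qed
        also have "\<dots> < \<delta>"
          using elim(2,4) by (simp add: z'_def r_def case_prod_unfold)
        finally show "cut_dist (matrix_kernel n x) f < \<delta>" .
      qed
      show "{x \<in> space (PiM I (\<lambda>_. \<mu>)). cut_dist (matrix_kernel n x) f < \<delta>} \<in> sets (PiM I (\<lambda>_. \<mu>))"
        using cut_ball_measurable [OF f sets_mu, of n \<delta>] by (simp add: entries_law_def I_def)
    qed
    ultimately have "1 / 2 \<le> exp ((c + e) * (real n)\<^sup>2) * Qn_ball \<mu> n f \<delta>"
      using half by (meson exp_ge_zero mult_left_mono order_trans)
    then have "exp (- ((c + e) * (real n)\<^sup>2)) * (1 / 2)
        \<le> exp (- ((c + e) * (real n)\<^sup>2)) * (exp ((c + e) * (real n)\<^sup>2) * Qn_ball \<mu> n f \<delta>)"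
      by (rule mult_left_mono) simp
    also have "\<dots> = Qn_ball \<mu> n f \<delta>"
      unfolding mult.assoc [symmetric] exp_add [symmetric] by simp
    finally show ?case unfolding mult_minus_left by simp
  qed
qed

end

section \<open>Choice of the tilts and balance of the errors\<close>

context gauss_tail
begin

text \<open>The parameters are functions of the prescribed mean alone, chosen before
  \<open>c\<close>. Cells (i, j) and (j, i) with equal averages therefore receive equal tilts, and
  the tilted means inherit the symmetry of the averages.\<close>

lemma ex_tilt_family:
  assumes e: "e > 0"
  shows "\<exists>\<theta> l K z. \<forall>a c. (\<forall>t. t * a - ln (mgf \<mu> t) \<le> c) \<longrightarrow>
      (\<integral>x. indicator {- K a..K a} x * exp (\<theta> a * x - l a) \<partial>\<mu>) = 1 \<and>
      (\<integral>x. x * (indicator {- K a..K a} x * exp (\<theta> a * x - l a)) \<partial>\<mu>) = z a \<and>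
      \<bar>z a - a\<bar> \<le> e \<and> \<theta> a * z a - l a \<le> c + e"
proof -
  define good where "good a q \<longleftrightarrow> (case q of (\<theta>, l, K, z) \<Rightarrow>
      (\<integral>x. indicator {- K..K} x * exp (\<theta> * x - l) \<partial>\<mu>) = 1 \<and>
      (\<integral>x. x * (indicator {- K..K} x * exp (\<theta> * x - l)) \<partial>\<mu>) = z \<and>
      \<bar>z - a\<bar> \<le> e \<and> (\<forall>c. (\<forall>t. t * a - ln (mgf \<mu> t) \<le> c) \<longrightarrow> \<theta> * z - l \<le> c + e))" for a and q :: "real \<times> real \<times> real \<times> real"
  have "\<exists>q. good a q" if c: "\<And>t. t * a - ln (mgf \<mu> t) \<le> c" for a c
  proof -
    \<comment> \<open>\<open>s\<close> is the real value of the rate at \<open>a\<close>, the least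
      admissible \<open>c\<close>; a tilt that is good for \<open>s\<close> is good for every other
      \<open>c\<close>.\<close>
    define s where "s = (SUP t. t * a - ln (mgf \<mu> t))"
    have bdd: "bdd_above (range (\<lambda>t. t * a - ln (mgf \<mu> t)))"
      using c by (intro bdd_aboveI2)
    have "t * a - ln (mgf \<mu> t) \<le> s" for t
      unfolding s_def by (rule cSUP_upper [OF _ bdd]) simp
    then obtain t l K where tlK:
      "(\<integral>x. indicator {- K..K} x * exp (t * x - l) \<partial>\<mu>) = 1"
      "\<bar>(\<integral>x. x * (indicator {- K..K} x * exp (t * x - l)) \<partial>\<mu>) - a\<bar> \<le> e"
      "t * (\<integral>x. x * (indicator {- K..K} x * exp (t * x - l)) \<partial>\<mu>) - l \<le> s + e"
      using ex_truncated_tilt [of a s e] e by blast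
    have "s \<le> c" if "\<forall>t. t * a - ln (mgf \<mu> t) \<le> c" for c
      unfolding s_def using that by (intro cSUP_least) auto
    then have "good a (t, l, K, \<integral>x. x * (indicator {- K..K} x * exp (t * x - l)) \<partial>\<mu>)"
      using tlK by (fastforce simp: good_def)
    then show ?thesis by blast
  qed
  then obtain q where q: "\<And>a c. (\<And>t. t * a - ln (mgf \<mu> t) \<le> c) \<Longrightarrow> good a (q a)"
    by metis
  show ?thesis
  proof (intro exI allI impI)
    fix a c assume c: "\<forall>t. t * a - ln (mgf \<mu> t) \<le> c"
    then have "good a (q a)" using q by blast
    then show "(\<integral>x. indicator {- fst (snd (snd (q a)))..fst (snd (snd (q a)))} x * exp (fst (q a) * x - fst (snd (q a))) \<partial>\<mu>) = 1 \<and>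
      (\<integral>x. x * (indicator {- fst (snd (snd (q a)))..fst (snd (snd (q a)))} x * exp (fst (q a) * x - fst (snd (q a)))) \<partial>\<mu>) = snd (snd (snd (q a))) \<and>
      \<bar>snd (snd (snd (q a))) - a\<bar> \<le> e \<and> fst (q a) * snd (snd (snd (q a))) - fst (snd (q a)) \<le> c + e"
      using c unfolding good_def by (cases "q a") auto
  qed
qed

lemma eventually_Qn_ball_ge:
  assumes f: "f \<in> kernel_space" and rate: "rate_I \<mu> f < \<infinity>" and \<delta>: "\<delta> > 0" and \<eta>: "\<eta> > 0"
  shows "\<forall>\<^sub>F n in sequentially. exp (- (enn2real (rate_I \<mu> f) + \<eta>) * (real n)\<^sup>2) / 2 \<le> Qn_ball \<mu> n f \<delta>"
proof -
  define R where "R = enn2real (rate_I \<mu> f)"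
  \<comment> \<open>Distance: averaging, tilting, refinement and the cut norm fluctuation use e
    each, so 4 e < \<delta>. Exponent: tilting, refinement and the diagonal add 3 e to 2 R; halving
    leaves at most R + 2 e, and the fluctuation of the likelihood adds the third e \<le> \<eta> /
    3.\<close>
  define e where "e = min (\<delta> / 5) (\<eta> / 3)"
  have e: "e > 0" "5 * e \<le> \<delta>" "3 * e \<le> \<eta>"
    using \<delta> \<eta> by (auto simp: e_def min_def)
  obtain g where g: "integrable lborel g" and off: "\<And>p. p \<notin> half_sq \<Longrightarrow> g p = 0"
    and sym: "\<And>x y. g (x, y) = g (y, x)" and fg: "AE p in lborel. p \<in> unit_sq \<longrightarrow> f p = g p"
    using ex_borel_version [OF f] by blast
  have [measurable]: "g \<in> borel_measurable borel"
    using borel_measurable_integrable [OF g] by simp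
  obtain m where m: "m > 0" and gm: "(\<integral>p. \<bar>g p - step_kernel m (cell_avg m g) p\<bar> \<partial>lborel) < e"
    using cell_avg_approx [OF g off e(1)] by auto
  define a where "a = cell_avg m g"
  define C where "C i j = (\<integral>\<^sup>+p. e2ennreal (cramer_rate \<mu> (g p)) * indicator (grid_cell m i j) p \<partial>lborel)" for i j
  have C: "C i j < \<infinity>" if "i < m" "j < m" for i j
    unfolding C_def by (rule sum_cell_rates(1) [OF f g off fg rate m that])
  have sumC: "(\<Sum>i<m. \<Sum>j<m. enn2real (C i j)) = 2 * R"
    unfolding C_def R_def by (rule sum_cell_rates(2) [OF f g off fg rate m])
  have aC: "t * a i j - ln (mgf \<mu> t) \<le> (real m)\<^sup>2 * enn2real (C i j)" if "i < m" "j < m" for i j t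
    using cell_avg_affine_le [OF f g off fg _ m] C [OF that] unfolding a_def C_def by blast
  obtain \<theta> l K z where "\<forall>a c. (\<forall>t. t * a - ln (mgf \<mu> t) \<le> c) \<longrightarrow>
      (\<integral>x. indicator {- K a..K a} x * exp (\<theta> a * x - l a) \<partial>\<mu>) = 1 \<and>
      (\<integral>x. x * (indicator {- K a..K a} x * exp (\<theta> a * x - l a)) \<partial>\<mu>) = z a \<and>
      \<bar>z a - a\<bar> \<le> e \<and> \<theta> a * z a - l a \<le> c + e"
    using ex_tilt_family [OF e(1)] by (elim exE)
  note tilt = this [rule_format]
  define Z where "Z i j = z (a i j)" for i j
  define \<kappa> where "\<kappa> i j = \<theta> (a i j) * z (a i j) - l (a i j)" for i j
  have a_sym: "a i j = a j i" for i j
    unfolding a_def by (rule cell_avg_commute) (use sym in auto)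
  have Za: "\<bar>Z i j - a i j\<bar> \<le> e" if "i < m" "j < m" for i j
    unfolding Z_def using tilt [OF aC [OF that]] by blast
  have \<kappa>C: "\<kappa> i j \<le> (real m)\<^sup>2 * enn2real (C i j) + e" if "i < m" "j < m" for i j
    unfolding \<kappa>_def using tilt [OF aC [OF that]] by blast
  define r where "r n = refine_idx m n" for n
  have r: "r n i < m" for n i
    unfolding r_def by (rule refine_idx_less [OF m])
  have aZ: "(\<integral>p. \<bar>step_kernel m a p - step_kernel m Z p\<bar> \<partial>lborel) \<le> e"
  proof -
    have "(\<integral>p. \<bar>step_kernel m a p - step_kernel m Z p\<bar> \<partial>lborel)
        = (\<integral>p. step_kernel m (\<lambda>i j. \<bar>Z i j - a i j\<bar>) p \<partial>lborel)"
      by (intro Bochner_Integration.integral_cong refl) (auto simp: step_kernel_def indicator_def)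
    also have "\<dots> = (\<Sum>i<m. \<Sum>j<m. \<bar>Z i j - a i j\<bar>) / (real m)\<^sup>2"
      by (rule integral_step_kernel [OF m])
    also have "\<dots> \<le> (\<Sum>i<m. \<Sum>j<m. e) / (real m)\<^sup>2"
      by (intro divide_right_mono sum_mono Za) auto
    also have "\<dots> = e"
      using m by (simp add: power2_eq_square)
    finally show ?thesis .
  qed
  have "\<forall>\<^sub>F n in sequentially.
      (\<integral>p. \<bar>step_kernel m Z p - step_kernel n (\<lambda>i j. Z (r n i) (r n j)) p\<bar> \<partial>lborel) < e"
    unfolding r_def by (rule order_tendstoD(2) [OF step_kernel_refine_tendsto [OF m] e(1)])
  then have L1: "\<forall>\<^sub>F n in sequentially. e + (LINT p:unit_sq|lebesgue.
      \<bar>matrix_kernel n (\<lambda>(i, j). Z (refine_idx m n i) (refine_idx m n j)) p - f p\<bar>) < \<delta>"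
    using eventually_gt_at_top [of 0]
  proof eventually_elim
    case (elim n)
    let ?Zn = "\<lambda>i j. Z (r n i) (r n j)"
    \<comment> \<open>The averages are symmetric, so rebuilding the matrix from its upper triangle
      changes nothing.\<close>
    have s: "sym_entry (\<lambda>(i, j). ?Zn i j) = ?Zn"
      using a_sym by (auto simp: sym_entry_def Z_def fun_eq_iff)
    note int = g integrable_step_kernel [OF m] integrable_step_kernel [OF elim(2)]
    have "(LINT p:unit_sq|lebesgue. \<bar>matrix_kernel n (\<lambda>(i, j). ?Zn i j) p - f p\<bar>)
        = (\<integral>p. \<bar>g p - step_kernel n ?Zn p\<bar> \<partial>lborel)"
      using L1_dist_eq_lborel [OF f g off fg elim(2), of "\<lambda>(i, j). ?Zn i j"] unfolding s by simp
    also have "\<dots> \<le> (\<integral>p. \<bar>g p - step_kernel m a p\<bar> + \<bar>step_kernel m a p - step_kernel m Z p\<bar>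
        + \<bar>step_kernel m Z p - step_kernel n ?Zn p\<bar> \<partial>lborel)"
      using int by (intro integral_mono) auto
    also have "\<dots> = (\<integral>p. \<bar>g p - step_kernel m a p\<bar> \<partial>lborel) + (\<integral>p. \<bar>step_kernel m a p - step_kernel m Z p\<bar> \<partial>lborel)
        + (\<integral>p. \<bar>step_kernel m Z p - step_kernel n ?Zn p\<bar> \<partial>lborel)"
      using int by simp
    also have "\<dots> < 3 * e"
      using gm aZ elim(1) unfolding a_def [symmetric] by linarith
    finally show ?case
      using e unfolding r_def by linarith
  qed
  define B where "B = (\<Sum>i<m. \<Sum>j<m. \<bar>\<kappa> i j\<bar>)"
  have step_\<kappa>: "(\<integral>p. step_kernel m \<kappa> p \<partial>lborel) \<le> 2 * R + e"
  proof -
    have "(\<integral>p. step_kernel m \<kappa> p \<partial>lborel) = (\<Sum>i<m. \<Sum>j<m. \<kappa> i j) / (real m)\<^sup>2"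
      by (rule integral_step_kernel [OF m])
    also have "\<dots> \<le> (\<Sum>i<m. \<Sum>j<m. (real m)\<^sup>2 * enn2real (C i j) + e) / (real m)\<^sup>2"
      by (intro divide_right_mono sum_mono \<kappa>C) auto
    also have "(\<Sum>i<m. \<Sum>j<m. (real m)\<^sup>2 * enn2real (C i j) + e) = (real m)\<^sup>2 * (2 * R + e)"
      unfolding sumC [symmetric]
      by (simp add: sum.distrib sum_distrib_left power2_eq_square distrib_left mult_ac)
    also have "\<dots> / (real m)\<^sup>2 = 2 * R + e"
      using m by simp
    finally show ?thesis .
  qed
  have "\<forall>\<^sub>F n in sequentially.
      (\<integral>p. \<bar>step_kernel m \<kappa> p - step_kernel n (\<lambda>i j. \<kappa> (r n i) (r n j)) p\<bar> \<partial>lborel) < e"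
    unfolding r_def by (rule order_tendstoD(2) [OF step_kernel_refine_tendsto [OF m] e(1)])
  moreover have "\<forall>\<^sub>F n in sequentially. real n > B / e"
    using filterlim_at_top_dense filterlim_real_sequentially by blast
  ultimately have cost: "\<forall>\<^sub>F n in sequentially. (\<Sum>(i, j)\<in>upper_idx n. \<kappa> (r n i) (r n j)) \<le> (R + 2 * e) * (real n)\<^sup>2"
    using eventually_gt_at_top [of 0]
  proof eventually_elim
    case (elim n)
    let ?k = "\<lambda>i j. \<kappa> (r n i) (r n j)"
    have "(\<integral>p. step_kernel n ?k p \<partial>lborel) - (\<integral>p. step_kernel m \<kappa> p \<partial>lborel)
        \<le> (\<integral>p. \<bar>step_kernel m \<kappa> p - step_kernel n ?k p\<bar> \<partial>lborel)"
      using integral_abs_bound [of lborel "\<lambda>p. step_kernel m \<kappa> p - step_kernel n ?k p"]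
        integrable_step_kernel [OF m] integrable_step_kernel [OF elim(3)] by simp
    then have "(\<Sum>i<n. \<Sum>j<n. ?k i j) / (real n)\<^sup>2 \<le> 2 * R + 2 * e"
      using elim(1) step_\<kappa> unfolding integral_step_kernel [OF elim(3)] by linarith
    then have 1: "(\<Sum>i<n. \<Sum>j<n. ?k i j) \<le> (2 * R + 2 * e) * (real n)\<^sup>2"
      using elim(3) by (simp add: field_simps)
    \<comment> \<open>The diagonal has only n terms, each at most B, so it is negligible against e
      n^2 once n > B / e.\<close>
    have "(\<Sum>i<n. ?k i i) \<le> (\<Sum>i<n. B)"
      using member_le_double_sum [OF r r, of \<kappa>] unfolding B_def by (intro sum_mono) (meson abs_le_D1)
    also have "\<dots> = real n * B" by simp
    also have "\<dots> \<le> real n * (e * real n)"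
      using elim(2,3) e(1) by (intro mult_left_mono) (auto simp: field_simps)
    finally have 2: "(\<Sum>i<n. ?k i i) \<le> e * (real n)\<^sup>2"
      by (simp add: power2_eq_square mult_ac)
    have "2 * (\<Sum>(i, j)\<in>upper_idx n. ?k i j) = (\<Sum>i<n. \<Sum>j<n. ?k i j) + (\<Sum>i<n. ?k i i)"
      using a_sym by (intro sum_upper_idx) (simp add: \<kappa>_def)
    also have "\<dots> \<le> (2 * R + 2 * e) * (real n)\<^sup>2 + e * (real n)\<^sup>2"
      using 1 2 by linarith
    also have "\<dots> \<le> 2 * ((R + 2 * e) * (real n)\<^sup>2)"
      using e(1) by (simp add: algebra_simps)
    finally show ?case by simp
  qed
  have "\<forall>\<^sub>F n in sequentially. exp (- ((R + 2 * e) + e) * (real n)\<^sup>2) / 2 \<le> Qn_ball \<mu> n f \<delta>"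
  proof (rule Qn_ball_ge [where z = Z and \<theta> = "\<lambda>i j. \<theta> (a i j)" and l = "\<lambda>i j. l (a i j)"
        and K = "\<lambda>i j. K (a i j)", OF kernel_space_integrable [OF f] m e(1)])
    fix i j assume ij: "i < m" "j < m"
    show "(\<integral>x. indicator {- K (a i j)..K (a i j)} x * exp (\<theta> (a i j) * x - l (a i j)) \<partial>\<mu>) = 1"
      "(\<integral>x. x * (indicator {- K (a i j)..K (a i j)} x * exp (\<theta> (a i j) * x - l (a i j))) \<partial>\<mu>) = Z i j"
      using tilt [OF aC [OF ij]] by (auto simp: Z_def)
  next
    show "\<forall>\<^sub>F n in sequentially. e + (LINT p:unit_sq|lebesgue.
      \<bar>matrix_kernel n (\<lambda>(i, j). Z (refine_idx m n i) (refine_idx m n j)) p - f p\<bar>) < \<delta>"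
      by (rule L1)
  next
    show "\<forall>\<^sub>F n in sequentially. (\<Sum>(i, j)\<in>upper_idx n.
      \<theta> (a (refine_idx m n i) (refine_idx m n j)) * Z (refine_idx m n i) (refine_idx m n j)
        - l (a (refine_idx m n i) (refine_idx m n j))) \<le> (R + 2 * e) * (real n)\<^sup>2"
      using cost unfolding \<kappa>_def Z_def r_def .
  qed
  then show ?thesis
  proof eventually_elim
    case (elim n)
    have "- (R + \<eta>) * (real n)\<^sup>2 \<le> - ((R + 2 * e) + e) * (real n)\<^sup>2"
      using e by (intro mult_right_mono) auto
    then have "exp (- (R + \<eta>) * (real n)\<^sup>2) \<le> exp (- ((R + 2 * e) + e) * (real n)\<^sup>2)"
      by (simp only: exp_le_cancel_iff)
    then show ?case using elim unfolding R_def by linarith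
  qed
qed

end

theorem theorem3p1:
  fixes \<mu> :: "real measure" and f :: "real \<times> real \<Rightarrow> real" and \<delta> :: real
  assumes "prob_space \<mu>" and "sets \<mu> = sets borel"
    and "\<exists>\<theta>>0. integrable \<mu> (\<lambda>x. exp (\<theta> * x\<^sup>2))"
    and "f \<in> kernel_space"
    and "rate_I \<mu> f < \<infinity>"
    and "\<delta> > 0"
  shows "liminf (\<lambda>n. elog (Qn_ball \<mu> n f \<delta>) / ereal ((real n)\<^sup>2))
           \<ge> - enn2ereal (rate_I \<mu> f)"
proof -
  interpret gauss_tail \<mu>
    using assms(1-3) by (simp add: gauss_tail_def gauss_tail_axioms_def)
  define R where "R = enn2real (rate_I \<mu> f)"
  let ?X = "\<lambda>n. elog (Qn_ball \<mu> n f \<delta>) / ereal ((real n)\<^sup>2)"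
  have R: "enn2ereal (rate_I \<mu> f) = ereal R"
    using assms(5) by (cases "rate_I \<mu> f") (simp_all add: R_def enn2ereal_ennreal)
  have le: "ereal (- R - \<eta>) \<le> liminf ?X" if \<eta>: "\<eta> > 0" for \<eta>
  proof (rule Liminf_bounded)
    \<comment> \<open>Half of \<eta> is the slack in the exponent; the other half, times n^2,
      absorbs the ln 2 that comes from the factor 1/2.\<close>
    have "\<forall>\<^sub>F n in sequentially. real n > 2 * ln 2 / \<eta>"
      using filterlim_at_top_dense filterlim_real_sequentially by blast
    moreover have "\<forall>\<^sub>F n in sequentially. exp (- (R + \<eta> / 2) * (real n)\<^sup>2) / 2 \<le> Qn_ball \<mu> n f \<delta>"
      unfolding R_def by (rule eventually_Qn_ball_ge) (use assms \<eta> in auto)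
    ultimately show "\<forall>\<^sub>F n in sequentially. ereal (- R - \<eta>) \<le> ?X n"
      using eventually_gt_at_top [of 0]
    proof eventually_elim
      case (elim n)
      let ?q = "Qn_ball \<mu> n f \<delta>"
      have pos: "?q > 0"
        by (rule less_le_trans [OF _ elim(2)]) simp
      have "ln (exp (- (R + \<eta> / 2) * (real n)\<^sup>2) / 2) \<le> ln ?q"
        using elim(2) pos by (subst ln_le_cancel_iff) auto
      then have 1: "- (R + \<eta> / 2) * (real n)\<^sup>2 - ln 2 \<le> ln ?q"
        by (simp add: ln_div)
      have "ln 2 \<le> \<eta> / 2 * real n"
        using elim(1) \<eta> by (simp add: field_simps)
      also have "\<dots> \<le> \<eta> / 2 * (real n)\<^sup>2"
        using elim(3) \<eta> by (intro mult_left_mono) (auto simp: power2_eq_square)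
      finally have "(- R - \<eta>) * (real n)\<^sup>2 \<le> ln ?q"
        using 1 by (simp add: algebra_simps)
      then have "- R - \<eta> \<le> ln ?q / (real n)\<^sup>2"
        using elim(3) by (simp add: field_simps)
      then show ?case
        using pos elim(3) by (simp add: elog_def)
    qed
  qed
  have "- ereal R \<le> liminf ?X + ereal \<eta>" if "\<eta> > 0" for \<eta>
  proof -
    have "- ereal R = ereal (- R - \<eta>) + ereal \<eta>" by simp
    also have "\<dots> \<le> liminf ?X + ereal \<eta>"
      using le [OF that] by (rule add_right_mono)
    finally show ?thesis .
  qed
  then show ?thesis
    unfolding R by (rule ereal_le_epsilon2) blast
qed

end
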